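(* Let $G=(V,E)$ be an infinite, locally finite, connected graph with a fixed vertex $x_0$. If there is a constant $c$ such that for all vertices $x$ of $G$ $$\frac{m_{+1}(x)-m_{-1}(x)}{m(x)}\ge c>0$$ and $$\underline{m}(r)=\min_{x\in S_r(x_0)}m(x)\to\infty\quad\text{as } r\to\infty,$$ then $\tilde{\Delta}$ has empty essential spectrum.
   Context: $m(x)$ is the valence (number of edges at $x$), $y\sim x$ means $x,y$ are joined by an edge, $d$ is the graph distance, $r(x)=d(x,x_0)$ and $S_r(x_0)=\{x: d(x,x_0)=r\}$. Put $m_{+1}(x)=\#\{y: y\sim x,\ r(y)=r(x)+1\}$ and $m_{-1}(x)=\#\{y: y\sim x,\ r(y)=r(x)-1\}$. The Laplacian is $\Delta f(x)=\sum_{y\sim x}(f(x)-f(y))$; with domain the finitely supported functions on $V$ it is essentially self-adjoint, and $\tilde{\Delta}$ denotes its unique self-adjoint extension to $\ell^2(V)$ (square summable functions, inner product $\sum_x f(x)g(x)$). The essential spectrum is the complement in the spectrum of the set of isolated eigenvalues of finite multiplicity. *)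

theory Defs
  imports "HOL-Analysis.Analysis"
begin

section \<open>Graphs\<close>

text \<open>
  The vertex set is the whole type \<open>'v\<close>.  An undirected simple graph is given by its adjacency
  relation: the edge joining \<open>x\<close> and \<open>y\<close> is represented by the two pairs
  \<open>(x, y)\<close> and \<open>(y, x)\<close>.
\<close>

definition simple_graph :: "('v \<times> 'v) set \<Rightarrow> bool" where
  "simple_graph E \<longleftrightarrow> sym E \<and> irrefl E"

definition locally_finite_graph :: "('v \<times> 'v) set \<Rightarrow> bool" where
  "locally_finite_graph E \<longleftrightarrow> (\<forall>x. finite (E `` {x}))"

definition connected_graph :: "('v \<times> 'v) set \<Rightarrow> bool" where
  "connected_graph E \<longleftrightarrow> (\<forall>x y. (x, y) \<in> E\<^sup>*)"

definition valence :: "('v \<times> 'v) set \<Rightarrow> 'v \<Rightarrow> nat" where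
  "valence E x = card (E `` {x})"

text \<open>The distance is the length of a shortest walk; it is only meaningful for connected graphs.\<close>

definition graph_dist :: "('v \<times> 'v) set \<Rightarrow> 'v \<Rightarrow> 'v \<Rightarrow> nat" where
  "graph_dist E x y = (LEAST n. (x, y) \<in> E ^^ n)"

definition graph_sphere :: "('v \<times> 'v) set \<Rightarrow> 'v \<Rightarrow> nat \<Rightarrow> 'v set" where
  "graph_sphere E x0 r = {x. graph_dist E x x0 = r}"

definition outer_valence :: "('v \<times> 'v) set \<Rightarrow> 'v \<Rightarrow> 'v \<Rightarrow> nat" where
  "outer_valence E x0 x = card {y \<in> E `` {x}. graph_dist E y x0 = graph_dist E x x0 + 1}"

text \<open>The condition is written additively because subtraction on \<open>nat\<close> truncates.\<close>

definition inner_valence :: "('v \<times> 'v) set \<Rightarrow> 'v \<Rightarrow> 'v \<Rightarrow> nat" where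
  "inner_valence E x0 x = card {y \<in> E `` {x}. graph_dist E y x0 + 1 = graph_dist E x x0}"

text \<open>
  In an infinite, connected, locally finite graph every sphere is finite and nonempty, so that
  the minimum is taken over a finite nonempty set.
\<close>

definition min_valence_sphere :: "('v \<times> 'v) set \<Rightarrow> 'v \<Rightarrow> nat \<Rightarrow> nat" where
  "min_valence_sphere E x0 r = Min (valence E ` graph_sphere E x0 r)"

definition laplacian :: "('v \<times> 'v) set \<Rightarrow> ('v \<Rightarrow> real) \<Rightarrow> 'v \<Rightarrow> real" where
  "laplacian E f x = (\<Sum>y \<in> E `` {x}. f x - f y)"


section \<open>Square summable functions\<close>

typedef 'v ell2 = "{f :: 'v \<Rightarrow> real. (\<lambda>x. (f x)\<^sup>2) summable_on UNIV}"
  morphisms ell2_fun Abs_ell2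
  by (rule exI[of _ "\<lambda>_. 0"]) simp

setup_lifting type_definition_ell2

lemma ell2_mult_summable:
  fixes f g :: "'v \<Rightarrow> real"
  assumes "(\<lambda>x. (f x)\<^sup>2) summable_on UNIV" "(\<lambda>x. (g x)\<^sup>2) summable_on UNIV"
  shows "(\<lambda>x. f x * g x) summable_on UNIV"
proof -
  have "(\<lambda>x. (f x)\<^sup>2 + (g x)\<^sup>2) summable_on UNIV"
    using assms by (rule summable_on_add)
  then have "(\<lambda>x. norm (f x * g x)) summable_on UNIV"
  proof (rule summable_on_comparison_test)
    fix x
    have "0 \<le> (\<bar>f x\<bar> - \<bar>g x\<bar>)\<^sup>2" by simp
    then have "2 * (\<bar>f x\<bar> * \<bar>g x\<bar>) \<le> (f x)\<^sup>2 + (g x)\<^sup>2"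
      by (simp add: power2_diff)
    moreover have "0 \<le> \<bar>f x\<bar> * \<bar>g x\<bar>" by simp
    ultimately show "norm (f x * g x) \<le> (f x)\<^sup>2 + (g x)\<^sup>2"
      by (simp only: real_norm_def abs_mult)
  qed simp
  then show ?thesis
    using summable_on_iff_abs_summable_on_real by blast
qed

lemma ell2_add_summable:
  fixes f g :: "'v \<Rightarrow> real"
  assumes "(\<lambda>x. (f x)\<^sup>2) summable_on UNIV" "(\<lambda>x. (g x)\<^sup>2) summable_on UNIV"
  shows "(\<lambda>x. (f x + g x)\<^sup>2) summable_on UNIV"
proof -
  have "(\<lambda>x. ((f x)\<^sup>2 + (g x)\<^sup>2) + 2 * (f x * g x)) summable_on UNIV"
    using assms ell2_mult_summable[OF assms]
    by (intro summable_on_add summable_on_cmult_right)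
  then show ?thesis
    by (simp add: power2_sum mult.assoc)
qed

instantiation ell2 :: (type) real_inner
begin

lift_definition zero_ell2 :: "'a ell2" is "\<lambda>_. 0"
  by simp

lift_definition plus_ell2 :: "'a ell2 \<Rightarrow> 'a ell2 \<Rightarrow> 'a ell2" is "\<lambda>f g x. f x + g x"
  by (rule ell2_add_summable)

lift_definition uminus_ell2 :: "'a ell2 \<Rightarrow> 'a ell2" is "\<lambda>f x. - f x"
  by simp

lift_definition scaleR_ell2 :: "real \<Rightarrow> 'a ell2 \<Rightarrow> 'a ell2" is "\<lambda>r f x. r * f x"
  by (simp add: power_mult_distrib summable_on_cmult_right)

lift_definition inner_ell2 :: "'a ell2 \<Rightarrow> 'a ell2 \<Rightarrow> real" is "\<lambda>f g. \<Sum>\<^sub>\<infinity>x. f x * g x" .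

definition "f - g = f + - (g :: 'a ell2)"
definition "norm f = sqrt (inner f (f :: 'a ell2))"
definition "dist f g = norm (f - (g :: 'a ell2))"
definition "sgn f = scaleR (inverse (norm f)) (f :: 'a ell2)"
definition "(uniformity :: ('a ell2 \<times> 'a ell2) filter) =
  (INF e\<in>{0<..}. principal {(f, g). dist f g < e})"
definition "open (U :: 'a ell2 set) \<longleftrightarrow>
  (\<forall>f\<in>U. eventually (\<lambda>(f', g). f' = f \<longrightarrow> g \<in> U) uniformity)"

instance
proof
  fix f g h :: "'a ell2" and a b :: real
  show "f + g + h = f + (g + h)" by transfer (simp add: add.assoc)
  show "f + g = g + f" by transfer (simp add: add.commute)
  show "0 + f = f" by transfer simp
  show "- f + f = 0" by transfer simp
  show "f - g = f + - g" by (rule minus_ell2_def)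
  show "a *\<^sub>R (f + g) = a *\<^sub>R f + a *\<^sub>R g" by transfer (simp add: algebra_simps)
  show "(a + b) *\<^sub>R f = a *\<^sub>R f + b *\<^sub>R f" by transfer (simp add: algebra_simps)
  show "a *\<^sub>R b *\<^sub>R f = (a * b) *\<^sub>R f" by transfer (simp add: mult.assoc)
  show "1 *\<^sub>R f = f" by transfer simp
  show "dist f g = norm (f - g)" by (rule dist_ell2_def)
  show "sgn f = scaleR (inverse (norm f)) f" by (rule sgn_ell2_def)
  show "inner f g = inner g f" by transfer (simp add: mult.commute)
  show "inner (f + g) h = inner f h + inner g h"
    by transfer (simp add: distrib_right infsum_add ell2_mult_summable)
  show "inner (a *\<^sub>R f) g = a * inner f g"
    by transfer (simp add: mult.assoc infsum_cmult_right')
  show "0 \<le> inner f f" by transfer (simp add: infsum_nonneg)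
  show "inner f f = 0 \<longleftrightarrow> f = 0"
  proof transfer
    fix f :: "'a \<Rightarrow> real"
    assume s: "(\<lambda>x. (f x)\<^sup>2) summable_on UNIV"
    show "(\<Sum>\<^sub>\<infinity>x. f x * f x) = 0 \<longleftrightarrow> f = (\<lambda>_. 0)"
    proof
      assume "(\<Sum>\<^sub>\<infinity>x. f x * f x) = 0"
      then have z: "(\<Sum>\<^sub>\<infinity>x. (f x)\<^sup>2) \<le> 0" by (simp add: power2_eq_square)
      show "f = (\<lambda>_. 0)"
      proof
        fix x
        have "(f x)\<^sup>2 = 0"
          using nonneg_infsum_le_0D[OF z s] by simp
        then show "f x = 0" by simp
      qed
    qed simp
  qed
  show "norm f = sqrt (inner f f)" by (rule norm_ell2_def)
qed (simp_all add: uniformity_ell2_def open_ell2_def)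

end


section \<open>Unbounded operators\<close>

text \<open>
  An operator \<open>A\<close> with domain \<open>Domain A\<close> is represented by its graph
  \<open>{(f, A f) | f \<in> Domain A}\<close>; in particular, inclusion of graphs is extension of operators.
\<close>

definition linear_operator :: "('h::real_inner \<times> 'h) set \<Rightarrow> bool" where
  "linear_operator A \<longleftrightarrow> subspace A \<and> single_valued A"

definition operator_adjoint :: "('h::real_inner \<times> 'h) set \<Rightarrow> ('h \<times> 'h) set" where
  "operator_adjoint A = {(g, h). \<forall>(f, k) \<in> A. inner k g = inner f h}"

definition self_adjoint :: "('h::real_inner \<times> 'h) set \<Rightarrow> bool" where
  "self_adjoint A \<longleftrightarrow>
     linear_operator A \<and> closure (Domain A) = UNIV \<and> operator_adjoint A = A"

text \<open>The graph of \<open>A - \<mu> I\<close>.\<close>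

definition operator_shift :: "('h::real_inner \<times> 'h) set \<Rightarrow> real \<Rightarrow> ('h \<times> 'h) set" where
  "operator_shift A \<mu> = {(f, k - \<mu> *\<^sub>R f) | f k. (f, k) \<in> A}"

text \<open>
  The resolvent set consists of those \<open>\<mu>\<close> for which \<open>A - \<mu> I\<close> maps its domain
  bijectively onto the whole space with a bounded inverse \<open>R\<close>.  Only real \<open>\<mu>\<close> occur, as the
  Hilbert space is real; the spectrum of a self-adjoint operator is real, so this is also the
  spectrum of the complexification.
\<close>

definition resolvent_set :: "('h::real_inner \<times> 'h) set \<Rightarrow> real set" where
  "resolvent_set A =
     {\<mu>. \<exists>R. bounded_linear R \<and> (operator_shift A \<mu>)\<inverse> = {(h, R h) | h. True}}"

definition spectrum :: "('h::real_inner \<times> 'h) set \<Rightarrow> real set" where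
  "spectrum A = - resolvent_set A"

definition eigenspace :: "('h::real_inner \<times> 'h) set \<Rightarrow> real \<Rightarrow> 'h set" where
  "eigenspace A \<mu> = {f. (f, \<mu> *\<^sub>R f) \<in> A}"

definition eigenvalue :: "('h::real_inner \<times> 'h) set \<Rightarrow> real \<Rightarrow> bool" where
  "eigenvalue A \<mu> \<longleftrightarrow> (\<exists>f \<in> eigenspace A \<mu>. f \<noteq> 0)"

definition finite_multiplicity :: "('h::real_inner \<times> 'h) set \<Rightarrow> real \<Rightarrow> bool" where
  "finite_multiplicity A \<mu> \<longleftrightarrow> (\<exists>B. finite B \<and> eigenspace A \<mu> \<subseteq> span B)"

definition essential_spectrum :: "('h::real_inner \<times> 'h) set \<Rightarrow> real set" where
  "essential_spectrum A =
     spectrum A -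
     {\<mu>. \<mu> isolated_in spectrum A \<and> eigenvalue A \<mu> \<and> finite_multiplicity A \<mu>}"


section \<open>The Laplacian as a self-adjoint operator\<close>

definition laplacian_fin :: "('v \<times> 'v) set \<Rightarrow> ('v ell2 \<times> 'v ell2) set" where
  "laplacian_fin E =
     {(f, g). finite {x. ell2_fun f x \<noteq> 0} \<and> ell2_fun g = laplacian E (ell2_fun f)}"

text \<open>
  The definition of \<^const>\<open>laplacian_fin\<close> would drop a function whose Laplacian is not square
  summable; on a locally finite graph none is dropped.
\<close>

lemma Domain_laplacian_fin:
  fixes E :: "('v \<times> 'v) set"
  assumes "simple_graph E" "locally_finite_graph E"
  shows "Domain (laplacian_fin E) = {f. finite {x. ell2_fun f x \<noteq> 0}}"
proof (intro equalityI subsetI)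
  fix f :: "'v ell2"
  assume "f \<in> {f. finite {x. ell2_fun f x \<noteq> 0}}"
  then have fin: "finite {x. ell2_fun f x \<noteq> 0}" (is "finite ?S") by simp
  let ?T = "?S \<union> (\<Union>x\<in>?S. E `` {x})"
  let ?g = "laplacian E (ell2_fun f)"
  have "finite ?T"
    using fin assms(2) by (auto simp: locally_finite_graph_def)
  moreover have "?g x = 0" if x: "x \<notin> ?T" for x
  proof -
    have "ell2_fun f x - ell2_fun f y = 0" if "y \<in> E `` {x}" for y
    proof -
      have "(y, x) \<in> E"
        using that assms(1) by (auto simp: simple_graph_def dest: symD)
      then show ?thesis using x by auto
    qed
    then show ?thesis by (simp add: laplacian_def)
  qed
  ultimately have "finite {x. (?g x)\<^sup>2 \<noteq> 0}"
    by (metis (mono_tags, lifting) finite_subset mem_Collect_eq subsetI zero_eq_power2)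
  then have "(\<lambda>x. (?g x)\<^sup>2) summable_on UNIV"
    by (intro finite_nonzero_values_imp_summable_on) simp
  then have "ell2_fun (Abs_ell2 ?g) = ?g"
    by (simp add: Abs_ell2_inverse)
  then have "(f, Abs_ell2 ?g) \<in> laplacian_fin E"
    using fin by (simp add: laplacian_fin_def)
  then show "f \<in> Domain (laplacian_fin E)" by blast
qed (auto simp: laplacian_fin_def)

text \<open>
  The definite description is meaningful when \<^const>\<open>laplacian_fin\<close> is essentially self-adjoint,
  i.e. has exactly one self-adjoint extension; the definition does not presuppose this.
\<close>

definition laplacian_sa :: "('v \<times> 'v) set \<Rightarrow> ('v ell2 \<times> 'v ell2) set" where
  "laplacian_sa E = (THE A. self_adjoint A \<and> laplacian_fin E \<subseteq> A)"

end

theory Submission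
  imports Defs "HOL-Complex_Analysis.Great_Picard"
begin

text \<open>
  The finitely supported Laplacian is symmetric and nonnegative, and a maximum principle shows that
  \<open>- 1\<close> is not an eigenvalue of its adjoint; hence its closure is its unique self-adjoint extension.
  Summation by parts along the distance to \<open>x0\<close> gives the Hardy inequality
  \<open>(\<Sum>x. m x * (f x)\<^sup>2) \<le> 2 / c\<^sup>2 * \<langle>f, \<Delta> f\<rangle>\<close>.  As only finitely many vertices have valence below any
  bound, the domain with the graph norm embeds compactly into the square summable functions, and
  a self-adjoint operator with this property has only isolated eigenvalues of finite multiplicity in
  its spectrum.
\<close>

section \<open>Orthogonal complements in a complete inner product space\<close>

text \<open>The domain of the self-adjoint extension is never described explicitly: inequalities are
  proved on finitely supported functions in a form that is a closed condition on pairs (f, g), and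
  so they hold on the closure of the graph. The Hardy inequality bounds multiplication by the
  valence, as a quadratic form, by the Laplacian. Divergence of the valence then forces functions of
  bounded graph norm to carry all but a small part of their mass on one finite set of vertices. The
  spectral part does without the spectral theorem: compactness makes \<open>A - \<mu>\<close>
  bounded below on the orthogonal complement of its kernel, and this one estimate yields both the
  bounded inverse and the gap around an eigenvalue.\<close>

lemma parallelogram_law:
  fixes a b :: "'h::real_inner"
  shows "(norm (a + b))\<^sup>2 + (norm (a - b))\<^sup>2 = 2 * (norm a)\<^sup>2 + 2 * (norm b)\<^sup>2"
  by (simp add: power2_norm_eq_inner inner_add_left inner_add_right inner_diff_left
      inner_diff_right inner_commute)

text \<open>Taking t = p / q, with p = <h, m> and q = <m, m>, lowers the squared norm by p^2 / q,
  which minimality forbids unless p = 0.\<close>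

lemma nearest_point_orthogonal:
  fixes h m :: "'h::real_inner"
  assumes "\<And>t. norm h \<le> norm (h - t *\<^sub>R m)"
  shows "inner h m = 0"
proof (cases "m = 0")
  case False
  define q where "q = inner m m"
  define p where "p = inner h m"
  have q: "q > 0" using False by (simp add: q_def)
  have "(norm h)\<^sup>2 \<le> (norm (h - (p / q) *\<^sub>R m))\<^sup>2"
    using assms by (simp add: power_mono)
  also have "\<dots> = (norm h)\<^sup>2 - 2 * (p / q) * p + (p / q)\<^sup>2 * q"
    unfolding power2_norm_eq_inner
    by (simp add: inner_diff_left inner_diff_right inner_commute p_def q_def
        algebra_simps power2_eq_square)
  also have "\<dots> = (norm h)\<^sup>2 - p\<^sup>2 / q"
    using q by (simp add: field_simps power2_eq_square)
  finally have "p\<^sup>2 / q \<le> 0" by simp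
  then show ?thesis using q by (simp add: p_def divide_le_0_iff)
qed simp

lemma Cauchy_if_norm_power2_bound:
  fixes u :: "nat \<Rightarrow> 'h::real_normed_vector"
  assumes "\<And>n k. (norm (u n - u k))\<^sup>2 \<le> b n + b k" and "b \<longlonglongrightarrow> (0::real)"
  shows "Cauchy u"
proof (rule metric_CauchyI)
  fix e :: real assume e: "0 < e"
  then have "\<forall>\<^sub>F n in sequentially. b n < e\<^sup>2 / 2"
    using assms(2) by (intro order_tendstoD) auto
  then obtain N where N: "\<And>n. n \<ge> N \<Longrightarrow> b n < e\<^sup>2 / 2"
    by (auto simp: eventually_sequentially)
  show "\<exists>M. \<forall>m\<ge>M. \<forall>n\<ge>M. dist (u m) (u n) < e"
  proof (intro exI allI impI)
    fix m n assume "N \<le> m" "N \<le> n"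
    then have "b m < e\<^sup>2 / 2" "b n < e\<^sup>2 / 2" using N by auto
    then have "(norm (u m - u n))\<^sup>2 < e\<^sup>2"
      using assms(1)[of m n] by linarith
    then show "dist (u m) (u n) < e"
      using e by (simp add: dist_norm power2_less_imp_less)
  qed
qed

text \<open>The witness is \<open>x - y\<close> for a point \<open>x\<close> outside
  \<open>M\<close> and its nearest point \<open>y\<close> in \<open>M\<close>, the limit of a
  minimising sequence.\<close>

lemma orthogonal_to_proper_closed_subspace:
  fixes M :: "'h::{real_inner,complete_space} set"
  assumes M: "subspace M" and cl: "closed M" and ne: "M \<noteq> UNIV"
  shows "\<exists>h. h \<noteq> 0 \<and> (\<forall>m\<in>M. inner h m = 0)"
proof -
  obtain x where x: "x \<notin> M" using ne by blast
  have M0: "M \<noteq> {}" using subspace_0[OF M] by blast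
  define d where "d = infdist x M"
  have d0: "0 \<le> d" by (simp add: d_def infdist_nonneg)
  have d_le: "d \<le> norm (x - m)" if "m \<in> M" for m
    using infdist_le[OF that, of x] by (simp add: d_def dist_norm)
  have "\<exists>m. m \<in> M \<and> (norm (x - m))\<^sup>2 < d\<^sup>2 + inverse (real (Suc n))" for n
  proof (rule ccontr)
    define s where "s = sqrt (d\<^sup>2 + inverse (real (Suc n)))"
    assume "\<not> ?thesis"
    then have "s \<le> dist x m" if "m \<in> M" for m
      using that by (auto simp: s_def dist_norm not_less intro!: real_le_lsqrt)
    then have "s \<le> (INF m\<in>M. dist x m)" using M0 by (intro cINF_greatest)
    then have "s \<le> d" by (simp only: d_def infdist_notempty[OF M0])
    moreover have "d < s" unfolding s_def by (intro real_less_rsqrt) simp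
    ultimately show False by simp
  qed
  then obtain u where u: "\<And>n. u n \<in> M"
    and ud: "\<And>n. (norm (x - u n))\<^sup>2 < d\<^sup>2 + inverse (real (Suc n))" by metis
  have "(norm (u n - u k))\<^sup>2 \<le> 2 * inverse (real (Suc n)) + 2 * inverse (real (Suc k))" for n k
  proof -
    \<comment> \<open>The midpoint is no closer to \<open>x\<close> than \<open>d\<close>. In the
      parallelogram law this cancels the terms in \<open>d\<close> and leaves only the excesses of
      the two squared distances.\<close>
    have "(1/2) *\<^sub>R (u n + u k) \<in> M" using M u by (simp add: subspace_add subspace_scale)
    then have "d \<le> norm (x - (1/2) *\<^sub>R (u n + u k))" by (rule d_le)
    also have "x - (1/2) *\<^sub>R (u n + u k) = (1/2) *\<^sub>R ((x - u n) + (x - u k))"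
      by (simp add: algebra_simps flip: scaleR_2)
    finally have "2 * d \<le> norm ((x - u n) + (x - u k))" by simp
    then have "(2 * d)\<^sup>2 \<le> (norm ((x - u n) + (x - u k)))\<^sup>2" using d0 by (intro power_mono) auto
    moreover have "norm ((x - u n) - (x - u k)) = norm (u n - u k)"
      by (simp add: norm_minus_commute)
    ultimately show ?thesis
      using parallelogram_law[of "x - u n" "x - u k"] ud[of n] ud[of k]
      by (simp add: power_mult_distrib)
  qed
  moreover have "(\<lambda>n. 2 * inverse (real (Suc n))) \<longlonglongrightarrow> 2 * 0"
    by (intro tendsto_mult tendsto_const LIMSEQ_inverse_real_of_nat)
  ultimately have "Cauchy u"
    using Cauchy_if_norm_power2_bound[of u "\<lambda>n. 2 * inverse (real (Suc n))"] by simp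
  then obtain y where y: "u \<longlonglongrightarrow> y" by (auto simp: Cauchy_convergent_iff convergent_def)
  have yM: "y \<in> M" using cl u y by (rule closed_sequentially)
  have "(\<lambda>n. (norm (x - u n))\<^sup>2) \<longlonglongrightarrow> (norm (x - y))\<^sup>2"
    by (intro tendsto_intros y)
  moreover have "(\<lambda>n. d\<^sup>2 + inverse (real (Suc n))) \<longlonglongrightarrow> d\<^sup>2 + 0"
    by (intro tendsto_add tendsto_const LIMSEQ_inverse_real_of_nat)
  ultimately have "(norm (x - y))\<^sup>2 \<le> d\<^sup>2 + 0"
    using ud by (intro LIMSEQ_le) (auto intro: less_imp_le)
  then have yd: "norm (x - y) \<le> d" using d0 by (auto intro: power2_le_imp_le)
  have "inner (x - y) m = 0" if "m \<in> M" for m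
  proof (rule nearest_point_orthogonal)
    fix t
    have "y + t *\<^sub>R m \<in> M" using M yM that by (simp add: subspace_add subspace_scale)
    then have "d \<le> norm (x - (y + t *\<^sub>R m))" by (rule d_le)
    then show "norm (x - y) \<le> norm (x - y - t *\<^sub>R m)"
      using yd by (simp add: diff_diff_eq)
  qed
  moreover have "x - y \<noteq> 0" using x yM by auto
  ultimately show ?thesis by blast
qed

lemma closure_sequentialI:
  fixes x :: "'a::metric_space"
  shows "(\<And>n. u n \<in> M) \<Longrightarrow> u \<longlonglongrightarrow> x \<Longrightarrow> x \<in> closure M"
  unfolding closure_sequential by (intro exI[of _ u]) simp

lemma subspace_closure:
  fixes M :: "'h::real_normed_vector set"
  assumes "subspace M"
  shows "subspace (closure M)"
proof (rule subspaceI)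
  show "0 \<in> closure M" using subspace_0[OF assms] closure_subset by blast
next
  fix x y assume "x \<in> closure M" "y \<in> closure M"
  then obtain u v where "\<And>n. u n \<in> M" "u \<longlonglongrightarrow> x" "\<And>n. v n \<in> M" "v \<longlonglongrightarrow> y"
    unfolding closure_sequential by blast
  then show "x + y \<in> closure M"
    using assms by (intro closure_sequentialI[of "\<lambda>n. u n + v n"] subspace_add tendsto_add)
next
  fix t :: real and x assume "x \<in> closure M"
  then obtain u where "\<And>n. u n \<in> M" "u \<longlonglongrightarrow> x"
    unfolding closure_sequential by blast
  then show "t *\<^sub>R x \<in> closure M"
    using assms by (intro closure_sequentialI[of "\<lambda>n. t *\<^sub>R u n"] subspace_scale tendsto_scaleR tendsto_const)
qed

text \<open>Serves for the range of \<open>L + 1\<close>, for the range of \<open>A - \<mu>\<close>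
  and for the domain of the Laplacian.\<close>

lemma dense_subspaceI:
  fixes M :: "'h::{real_inner,complete_space} set"
  assumes "subspace M" and "\<And>h. (\<And>m. m \<in> M \<Longrightarrow> inner h m = 0) \<Longrightarrow> h = 0"
  shows "closure M = UNIV"
proof (rule ccontr)
  assume "closure M \<noteq> UNIV"
  then obtain h where "h \<noteq> 0" "\<forall>m\<in>closure M. inner h m = 0"
    using orthogonal_to_proper_closed_subspace[of "closure M"] assms(1)
    by (auto simp: subspace_closure)
  then show False using assms(2)[of h] closure_subset by blast
qed

lemma orthogonal_to_dense:
  fixes h :: "'h::real_inner"
  assumes "closure M = UNIV" and "\<And>m. m \<in> M \<Longrightarrow> inner m h = 0"
  shows "h = 0"
proof -
  have "closed {m. inner m h = 0}"
    by (intro closed_Collect_eq continuous_intros)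
  then have "closure M \<subseteq> {m. inner m h = 0}"
    using assms(2) by (intro closure_minimal) auto
  then have "h \<in> {m. inner m h = 0}" using assms(1) by blast
  then show ?thesis by simp
qed

section \<open>Adjoints\<close>

lemma operator_adjoint_Inter:
  "operator_adjoint A = (\<Inter>(f, k)\<in>A. {p. inner k (fst p) = inner f (snd p)})"
  by (auto simp: operator_adjoint_def)

lemma closed_operator_adjoint:
  fixes A :: "('h::real_inner \<times> 'h) set"
  shows "closed (operator_adjoint A)"
proof -
  have "closed {p. inner k (fst p) = inner f (snd p)}" for f k :: 'h
    by (intro closed_Collect_eq continuous_intros)
  then show ?thesis
    unfolding operator_adjoint_Inter by auto
qed

lemma subspace_operator_adjoint:
  "subspace (operator_adjoint A)"
  by (force simp: subspace_def operator_adjoint_def zero_prod_def inner_add_right)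

lemma operator_adjoint_antimono: "A \<subseteq> B \<Longrightarrow> operator_adjoint B \<subseteq> operator_adjoint A"
  by (auto simp: operator_adjoint_def)

lemma operator_adjoint_closure:
  fixes A :: "('h::real_inner \<times> 'h) set"
  shows "operator_adjoint (closure A) = operator_adjoint A"
proof (intro equalityI subsetI)
  fix p assume p: "p \<in> operator_adjoint A"
  have "closed {q. inner (snd q) (fst p) = inner (fst q) (snd p)}"
    by (intro closed_Collect_eq continuous_intros)
  then have "closure A \<subseteq> {q. inner (snd q) (fst p) = inner (fst q) (snd p)}"
    using p by (intro closure_minimal) (auto simp: operator_adjoint_def)
  then show "p \<in> operator_adjoint (closure A)"
    by (auto simp: operator_adjoint_def)
qed (use operator_adjoint_antimono closure_subset in blast)

lemma single_valued_operator_adjoint: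
  fixes A :: "('h::real_inner \<times> 'h) set"
  assumes "closure (Domain A) = UNIV"
  shows "single_valued (operator_adjoint A)"
proof (rule single_valuedI)
  fix f g g' :: 'h
  assume "(f, g) \<in> operator_adjoint A" "(f, g') \<in> operator_adjoint A"
  then have "inner u (g - g') = 0" if "u \<in> Domain A" for u
    using that by (fastforce simp: operator_adjoint_def inner_diff_right)
  then have "g - g' = 0" using assms by (rule orthogonal_to_dense[rotated])
  then show "g = g'" by simp
qed

text \<open>
  Approximating \<open>f + g\<close> by values \<open>u + v\<close> of \<open>L + 1\<close>, whose range is dense and whose inverse is a
  contraction, produces an element of the closure which can differ from \<open>(f, g)\<close> only by an element
  of the kernel of \<open>L\<^sup>* + 1\<close>.
\<close>

lemma operator_adjoint_eq_closure:
  fixes L :: "('h::{real_inner,complete_space} \<times> 'h) set"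
  assumes L: "subspace L" and sym: "L \<subseteq> operator_adjoint L"
    and pos: "\<And>f k. (f, k) \<in> L \<Longrightarrow> 0 \<le> inner f k"
    and ker: "\<And>h. (h, - h) \<in> operator_adjoint L \<Longrightarrow> h = 0"
  shows "operator_adjoint L = closure L"
proof (rule equalityI)
  show cl: "closure L \<subseteq> operator_adjoint L"
    by (intro closure_minimal sym closed_operator_adjoint)
  show "operator_adjoint L \<subseteq> closure L"
  proof (rule subrelI)
    fix f g assume fg: "(f, g) \<in> operator_adjoint L"
    define M where "M = (\<lambda>(u, v). u + v) ` L"
    have "subspace M"
      unfolding M_def
      by (intro linear_subspace_image L linearI) (auto simp: algebra_simps)
    \<comment> \<open>Orthogonality to the range of \<open>L + 1\<close> says exactly that the
      adjoint sends \<open>h\<close> to \<open>- h\<close>.\<close>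
    moreover have "h = 0" if h: "\<And>m. m \<in> M \<Longrightarrow> inner h m = 0" for h
    proof (rule ker)
      have "inner v h = inner u (- h)" if "(u, v) \<in> L" for u v
      proof -
        have "u + v \<in> M" using that by (force simp: M_def)
        from h[OF this] show ?thesis by (simp add: inner_add_right inner_commute)
      qed
      then show "(h, - h) \<in> operator_adjoint L" by (auto simp: operator_adjoint_def)
    qed
    ultimately have "f + g \<in> closure M"
      using dense_subspaceI[of M] by blast
    then obtain w where w: "\<And>n. w n \<in> M" "w \<longlonglongrightarrow> f + g"
      by (auto simp: closure_sequential)
    have "\<forall>n. \<exists>u v. (u, v) \<in> L \<and> w n = u + v" using w(1) by (force simp: M_def)
    then obtain u v where uv: "\<And>n. (u n, v n) \<in> L" and wuv: "\<And>n. w n = u n + v n" by metis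
    have "norm (u n - u k) \<le> norm (w n - w k)" for n k
    proof -
      have "(u n - u k, v n - v k) \<in> L" using subspace_diff[OF L uv[of n] uv[of k]] by simp
      \<comment> \<open>For (a, b) in \<open>L\<close>, nonnegativity of <a, b> gives <a, a> \<le>
        <a, a + b>; this is the contraction property.\<close>
      then have "(norm (u n - u k))\<^sup>2 \<le> inner (u n - u k) (w n - w k)"
        using pos[of "u n - u k" "v n - v k"]
        by (simp add: wuv power2_norm_eq_inner algebra_simps)
      also have "\<dots> \<le> norm (u n - u k) * norm (w n - w k)"
        by (rule norm_cauchy_schwarz)
      finally show ?thesis by (cases "u n = u k") (auto simp: power2_eq_square)
    qed
    moreover have "Cauchy w" using w(2) by (auto intro: LIMSEQ_imp_Cauchy)
    ultimately have "Cauchy u"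
      unfolding Cauchy_def dist_norm by (meson le_less_trans)
    then obtain f' where f': "u \<longlonglongrightarrow> f'" by (auto simp: Cauchy_convergent_iff convergent_def)
    have "(\<lambda>n. w n - u n) \<longlonglongrightarrow> f + g - f'" by (intro tendsto_diff w(2) f')
    then have "v \<longlonglongrightarrow> f + g - f'" by (simp add: wuv)
    with f' have "(\<lambda>n. (u n, v n)) \<longlonglongrightarrow> (f', f + g - f')" by (rule tendsto_Pair)
    then have L': "(f', f + g - f') \<in> closure L" using uv by (intro closure_sequentialI)
    then have "(f - f', g - (f + g - f')) \<in> operator_adjoint L"
      using subspace_diff[OF subspace_operator_adjoint fg, of "(f', f + g - f')"] cl by auto
    then have "f - f' = 0" using ker[of "f - f'"] by simp
    then show "(f, g) \<in> closure L" using L' by simp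
  qed
qed

text \<open>The adjoint of \<open>L\<close> is the closure of \<open>L\<close>, and closing an
  operator does not change its adjoint, so the second adjoint equals the first.\<close>

lemma self_adjoint_operator_adjoint:
  fixes L :: "('h::real_inner \<times> 'h) set"
  assumes "closure (Domain L) = UNIV" and sym: "L \<subseteq> operator_adjoint L"
    and "operator_adjoint L = closure L"
  shows "self_adjoint (operator_adjoint L)"
proof -
  have "closure (Domain L) \<subseteq> closure (Domain (operator_adjoint L))"
    by (intro closure_mono Domain_mono sym)
  then have "closure (Domain (operator_adjoint L)) = UNIV" using assms(1) by auto
  moreover have "operator_adjoint (operator_adjoint L) = operator_adjoint L"
    by (metis assms(3) operator_adjoint_closure)
  ultimately show ?thesis
    using assms(1) by (simp add: self_adjoint_def linear_operator_def subspace_operator_adjoint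
        single_valued_operator_adjoint)
qed

text \<open>Adjoints reverse inclusions: \<open>L \<subseteq> B\<close> puts \<open>B\<close> inside
  the adjoint of \<open>L\<close>, and a second application gives the converse because both
  operators are their own adjoints.\<close>

lemma self_adjoint_extension_unique:
  assumes "self_adjoint (operator_adjoint L)" and "self_adjoint B" and "L \<subseteq> B"
  shows "B = operator_adjoint L"
proof -
  have "B \<subseteq> operator_adjoint L"
    using operator_adjoint_antimono[OF assms(3)] assms(2) by (simp add: self_adjoint_def)
  moreover from operator_adjoint_antimono[OF this] have "operator_adjoint L \<subseteq> B"
    using assms(1,2) by (simp add: self_adjoint_def)
  ultimately show ?thesis by blast
qed

section \<open>Self-adjoint operators with compactly embedded domain\<close>

text \<open>A sequential form of compactness of the embedding of the domain with its graph norm. It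
  takes the place of a compact resolvent and can be stated before any resolvent point is
  known.\<close>

definition compact_domain :: "('h::real_inner \<times> 'h) set \<Rightarrow> bool" where
  "compact_domain A \<longleftrightarrow>
     (\<forall>f g K. (\<forall>n. (f n, g n) \<in> A \<and> norm (f n) \<le> K \<and> norm (g n) \<le> K) \<longrightarrow>
        (\<exists>l r. strict_mono (r :: nat \<Rightarrow> nat) \<and> (f \<circ> r) \<longlonglongrightarrow> l))"

lemma compact_domainE:
  fixes f g :: "nat \<Rightarrow> 'h::real_inner"
  assumes "compact_domain A" and "\<And>n. (f n, g n) \<in> A"
    and "\<And>n. norm (f n) \<le> K" and "\<And>n. norm (g n) \<le> K"
  obtains l r where "strict_mono (r :: nat \<Rightarrow> nat)" "(f \<circ> r) \<longlonglongrightarrow> l"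
  using assms unfolding compact_domain_def by metis

lemma self_adjoint_closed: "self_adjoint A \<Longrightarrow> closed A"
  by (metis closed_operator_adjoint self_adjoint_def)

lemma self_adjoint_subspace: "self_adjoint A \<Longrightarrow> subspace A"
  by (simp add: self_adjoint_def linear_operator_def)

lemma self_adjoint_symmetric:
  "self_adjoint A \<Longrightarrow> (f, k) \<in> A \<Longrightarrow> (g, h) \<in> A \<Longrightarrow> inner k g = inner f h"
  unfolding self_adjoint_def operator_adjoint_def by fast

lemma subspace_eigenspace:
  assumes "self_adjoint A"
  shows "subspace (eigenspace A \<mu>)"
proof (rule subspaceI)
  note A = self_adjoint_subspace[OF assms]
  show "0 \<in> eigenspace A \<mu>"
    using subspace_0[OF A] by (simp add: eigenspace_def zero_prod_def)
  show "x + y \<in> eigenspace A \<mu>" if "x \<in> eigenspace A \<mu>" "y \<in> eigenspace A \<mu>" for x y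
    using subspace_add[OF A, of "(x, \<mu> *\<^sub>R x)" "(y, \<mu> *\<^sub>R y)"] that
    by (simp add: eigenspace_def scaleR_add_right)
  show "t *\<^sub>R x \<in> eigenspace A \<mu>" if "x \<in> eigenspace A \<mu>" for t x
    using subspace_scale[OF A, of "(x, \<mu> *\<^sub>R x)" t] that
    by (simp add: eigenspace_def mult.commute)
qed

text \<open>Otherwise unit vectors orthogonal to the eigenspace have images under
  \<open>A - \<mu>\<close> tending to 0. A subsequence converges, closedness puts its limit into the
  eigenspace, and the limit is then a unit vector orthogonal to itself.\<close>

lemma coercive_on_eigenspace_complement:
  fixes A :: "('h::real_inner \<times> 'h) set"
  assumes sa: "self_adjoint A" and comp: "compact_domain A"
  shows "\<exists>C>0. \<forall>(f, g)\<in>A. (\<forall>e\<in>eigenspace A \<mu>. inner f e = 0) \<longrightarrow> norm f \<le> C * norm (g - \<mu> *\<^sub>R f)"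
proof (rule ccontr)
  define P where "P C \<longleftrightarrow> (\<forall>(f, g)\<in>A. (\<forall>e\<in>eigenspace A \<mu>. inner f e = 0) \<longrightarrow>
    norm f \<le> C * norm (g - \<mu> *\<^sub>R f))" for C
  assume "\<not> ?thesis"
  then have neg: "\<not> P C" if "C > 0" for C
    using that unfolding P_def by blast
  have "\<exists>F G. (F, G) \<in> A \<and> (\<forall>e\<in>eigenspace A \<mu>. inner F e = 0) \<and> norm F = 1 \<and>
          norm (G - \<mu> *\<^sub>R F) < inverse (real (Suc n))" for n
  proof -
    have "\<not> P (real (Suc n))" by (rule neg) simp
    then obtain f g where fg: "(f, g) \<in> A" "\<forall>e\<in>eigenspace A \<mu>. inner f e = 0"
      and lt: "real (Suc n) * norm (g - \<mu> *\<^sub>R f) < norm f" unfolding P_def by (auto intro: leI simp del: of_nat_Suc)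
    have f: "norm f > 0" using lt by (rule le_less_trans[rotated]) simp
    define t where "t = inverse (norm f)"
    have tA: "(t *\<^sub>R f, t *\<^sub>R g) \<in> A"
      using subspace_scale[OF self_adjoint_subspace[OF sa] fg(1), of t] by simp
    have t1: "norm (t *\<^sub>R f) = 1" using f by (simp add: t_def)
    have "t *\<^sub>R g - \<mu> *\<^sub>R t *\<^sub>R f = t *\<^sub>R (g - \<mu> *\<^sub>R f)" by (simp add: algebra_simps)
    then have "norm (t *\<^sub>R g - \<mu> *\<^sub>R t *\<^sub>R f) = norm (g - \<mu> *\<^sub>R f) / norm f"
      using f by (simp add: t_def divide_inverse)
    moreover have "norm (g - \<mu> *\<^sub>R f) / norm f < inverse (real (Suc n))"
      using f lt by (simp add: field_simps del: of_nat_Suc)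
    ultimately have "norm (t *\<^sub>R g - \<mu> *\<^sub>R t *\<^sub>R f) < inverse (real (Suc n))" by simp
    with tA t1 show ?thesis using fg(2) by (intro exI[of _ "t *\<^sub>R f"] exI[of _ "t *\<^sub>R g"]) auto
  qed
  then obtain F G where FG: "\<And>n. (F n, G n) \<in> A" and orth: "\<And>n e. e \<in> eigenspace A \<mu> \<Longrightarrow> inner (F n) e = 0"
    and F1: "\<And>n. norm (F n) = 1" and small: "\<And>n. norm (G n - \<mu> *\<^sub>R F n) < inverse (real (Suc n))"
    by metis
  have GK: "norm (G n) \<le> 1 + \<bar>\<mu>\<bar>" for n
  proof -
    have "norm (G n) \<le> norm (G n - \<mu> *\<^sub>R F n) + norm (\<mu> *\<^sub>R F n)"
      by (metis diff_add_cancel norm_triangle_ineq)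
    moreover have "inverse (real (Suc n)) \<le> 1" by (simp add: field_simps)
    ultimately show ?thesis using small[of n] F1[of n] by simp
  qed
  obtain l r where r: "strict_mono (r :: nat \<Rightarrow> nat)" and l: "(F \<circ> r) \<longlonglongrightarrow> l"
    by (rule compact_domainE[OF comp, of F G "1 + \<bar>\<mu>\<bar>"]) (use FG F1 GK in auto)
  have "(\<lambda>n. G n - \<mu> *\<^sub>R F n) \<longlonglongrightarrow> 0"
    by (rule Lim_null_comparison[OF _ LIMSEQ_inverse_real_of_nat])
      (intro always_eventually allI less_imp_le small)
  then have "((\<lambda>n. G n - \<mu> *\<^sub>R F n) \<circ> r) \<longlonglongrightarrow> 0" using r by (rule LIMSEQ_subseq_LIMSEQ)
  \<comment> \<open>Adding \<mu> F back to G - \<mu> F shows that G converges too, so the pairs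
    converge in the closed graph.\<close>
  then have "(\<lambda>n. ((\<lambda>n. G n - \<mu> *\<^sub>R F n) \<circ> r) n + \<mu> *\<^sub>R (F \<circ> r) n) \<longlonglongrightarrow> 0 + \<mu> *\<^sub>R l"
    by (intro tendsto_intros l)
  then have lim: "(\<lambda>n. ((F \<circ> r) n, G (r n))) \<longlonglongrightarrow> (l, \<mu> *\<^sub>R l)"
    using l by (intro tendsto_Pair) (auto simp: o_def)
  have "((F \<circ> r) n, G (r n)) \<in> A" for n using FG by simp
  from closed_sequentially[OF self_adjoint_closed[OF sa] this lim]
  have "(l, \<mu> *\<^sub>R l) \<in> A" .
  then have "l \<in> eigenspace A \<mu>" by (simp add: eigenspace_def)
  then have "inner ((F \<circ> r) n) l = 0" for n using orth by simp
  moreover have "(\<lambda>n. inner ((F \<circ> r) n) l) \<longlonglongrightarrow> inner l l" by (intro tendsto_intros l)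
  ultimately have "inner l l = 0" by (simp add: LIMSEQ_const_iff)
  moreover have "(\<lambda>n. norm ((F \<circ> r) n)) \<longlonglongrightarrow> norm l" by (intro tendsto_intros l)
  then have "norm l = 1" using F1 by (simp add: LIMSEQ_const_iff)
  ultimately show False by simp
qed

text \<open>Gram-Schmidt by dependent choice: some vector of \<open>N\<close> lies outside the span
  of those already chosen, and subtracting its projection leaves a nonzero vector to
  normalise.\<close>

lemma orthonormal_sequence_in_infinite_dimensional:
  fixes N :: "'h::real_inner set"
  assumes N: "subspace N" and inf: "\<And>B. finite B \<Longrightarrow> \<not> N \<subseteq> span B"
  shows "\<exists>e :: nat \<Rightarrow> 'h. \<forall>n. e n \<in> N \<and> norm (e n) = 1 \<and> (\<forall>i<n. inner (e i) (e n) = 0)"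
proof (rule dependent_wellorder_choice)
  fix n :: nat and e :: "nat \<Rightarrow> 'h"
  assume e: "\<And>j. j < n \<Longrightarrow> e j \<in> N \<and> norm (e j) = 1 \<and> (\<forall>i<j. inner (e i) (e j) = 0)"
  have orth: "inner (e i) (e j) = (if i = j then 1 else 0)" if "i < n" "j < n" for i j
    using e[OF that(1)] e[OF that(2)]
    by (cases i j rule: linorder_cases) (auto simp: inner_commute dot_square_norm)
  obtain w where w: "w \<in> N" "w \<notin> span (e ` {..<n})" using inf[of "e ` {..<n}"] by auto
  define v where "v = w - (\<Sum>j<n. inner w (e j) *\<^sub>R e j)"
  have "(\<Sum>j<n. inner w (e j) *\<^sub>R e j) \<in> span (e ` {..<n})"
    by (intro span_sum span_scale span_base) auto
  then have v0: "v \<noteq> 0" using w(2) by (auto simp: v_def)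
  have vN: "v \<in> N"
    unfolding v_def using e w(1) by (intro subspace_diff[OF N] subspace_sum[OF N] subspace_scale[OF N]) auto
  have v: "inner (e i) v = 0" if "i < n" for i
  proof -
    have "inner (e i) v = inner (e i) w - (\<Sum>j<n. inner w (e j) * inner (e i) (e j))"
      by (simp add: v_def inner_diff_right inner_sum_right)
    also have "(\<Sum>j<n. inner w (e j) * inner (e i) (e j)) = (\<Sum>j<n. if i = j then inner w (e j) else 0)"
      using that by (intro sum.cong) (auto simp: orth)
    also have "\<dots> = inner (e i) w" using that by (simp add: inner_commute)
    finally show ?thesis by simp
  qed
  show "\<exists>r. r \<in> N \<and> norm r = 1 \<and> (\<forall>i<n. inner (e i) r = 0)"
    using v0 vN v by (intro exI[of _ "inverse (norm v) *\<^sub>R v"]) (auto simp: subspace_scale[OF N])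
qed auto

text \<open>An orthonormal sequence of eigenvectors is bounded in graph norm, yet its members lie at
  mutual distance sqrt 2, so no subsequence is Cauchy.\<close>

lemma finite_multiplicity_if_compact_domain:
  fixes A :: "('h::real_inner \<times> 'h) set"
  assumes sa: "self_adjoint A" and comp: "compact_domain A"
  shows "finite_multiplicity A \<mu>"
proof (rule ccontr)
  assume "\<not> ?thesis"
  then obtain e :: "nat \<Rightarrow> 'h" where e: "\<And>n. e n \<in> eigenspace A \<mu>" "\<And>n. norm (e n) = 1"
    and orth: "\<And>i n. i < n \<Longrightarrow> inner (e i) (e n) = 0"
    using orthonormal_sequence_in_infinite_dimensional[OF subspace_eigenspace[OF sa], of \<mu>]
    unfolding finite_multiplicity_def by metis
  obtain l r where r: "strict_mono (r :: nat \<Rightarrow> nat)" and l: "(e \<circ> r) \<longlonglongrightarrow> l"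
  proof (rule compact_domainE[OF comp, of e "\<lambda>n. \<mu> *\<^sub>R e n" "max 1 \<bar>\<mu>\<bar>"])
    show "(e n, \<mu> *\<^sub>R e n) \<in> A" for n using e(1)[of n] by (simp add: eigenspace_def)
  qed (use e(2) in auto)
  have "Cauchy (e \<circ> r)" using l by (rule LIMSEQ_imp_Cauchy)
  then obtain M where "\<forall>m\<ge>M. \<forall>n\<ge>M. dist ((e \<circ> r) m) ((e \<circ> r) n) < 1"
    by (meson metric_CauchyD zero_less_one)
  then have "norm (e (r M) - e (r (Suc M))) < 1" by (auto simp: dist_norm)
  then have "(norm (e (r M) - e (r (Suc M))))\<^sup>2 < 1\<^sup>2" by (intro power_strict_mono) auto
  moreover have "inner (e (r M)) (e (r (Suc M))) = 0"
    using r by (intro orth) (simp add: strict_mono_def)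
  then have "(norm (e (r M) - e (r (Suc M))))\<^sup>2 = 2"
    by (simp add: dot_norm_neg e(2))
  ultimately show False by simp
qed

text \<open>The lower bound makes \<open>A - \<mu>\<close> injective with closed range. A vector
  orthogonal to the range lies in the kernel by self-adjointness, hence vanishes, so the range is
  everything; the inverse is bounded by the same \<open>C\<close>.\<close>

lemma resolvent_if_coercive:
  fixes A :: "('h::{real_inner,complete_space} \<times> 'h) set"
  assumes sa: "self_adjoint A"
    and C: "\<And>f g. (f, g) \<in> A \<Longrightarrow> norm f \<le> C * norm (g - \<mu> *\<^sub>R f)"
  shows "\<mu> \<in> resolvent_set A"
proof -
  have A: "subspace A" using sa by (rule self_adjoint_subspace)
  define M where "M = (\<lambda>(f, g). g - \<mu> *\<^sub>R f) ` A"
  have M: "subspace M"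
    unfolding M_def by (intro linear_subspace_image A linearI) (auto simp: algebra_simps)
  have M_iff: "h \<in> M \<longleftrightarrow> (\<exists>f. (f, h + \<mu> *\<^sub>R f) \<in> A)" for h
  proof
    assume "\<exists>f. (f, h + \<mu> *\<^sub>R f) \<in> A"
    then obtain f where "(f, h + \<mu> *\<^sub>R f) \<in> A" ..
    then show "h \<in> M" unfolding M_def by (rule rev_image_eqI) simp
  next
    assume "h \<in> M"
    then obtain f g where "(f, g) \<in> A" "h = g - \<mu> *\<^sub>R f" by (auto simp: M_def)
    then have "(f, h + \<mu> *\<^sub>R f) \<in> A" by simp
    then show "\<exists>f. (f, h + \<mu> *\<^sub>R f) \<in> A" ..
  qed
  have inj: "f = f'" if "(f, h + \<mu> *\<^sub>R f) \<in> A" "(f', h + \<mu> *\<^sub>R f') \<in> A" for f f' h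
  proof -
    have "(f - f', \<mu> *\<^sub>R (f - f')) \<in> A"
      using subspace_diff[OF A that] by (simp add: algebra_simps)
    from C[OF this] show ?thesis by simp
  qed
  have "closed M"
    unfolding closed_sequential_limits
  proof (intro allI impI, elim conjE)
    fix w x assume "\<forall>n. w n \<in> M" and wx: "w \<longlonglongrightarrow> x"
    then obtain f where f: "\<And>n. (f n, w n + \<mu> *\<^sub>R f n) \<in> A" unfolding M_iff by metis
    have le: "norm (f n - f k) \<le> C * norm (w n - w k)" for n k
      using C[of "f n - f k" "w n - w k + \<mu> *\<^sub>R (f n - f k)"] subspace_diff[OF A f[of n] f[of k]]
      by (simp add: algebra_simps)
    have "Cauchy w" using wx by (rule LIMSEQ_imp_Cauchy)
    have "Cauchy f"
    proof (rule metric_CauchyI)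
      fix e :: real assume e: "0 < e"
      \<comment> \<open>\<open>C\<close> carries no sign assumption, so
        \<open>\<bar>C\<bar> + 1\<close> serves as a positive bound to divide by.\<close>
      then obtain N where N: "\<forall>m\<ge>N. \<forall>n\<ge>N. dist (w m) (w n) < e / (\<bar>C\<bar> + 1)"
        using metric_CauchyD[OF \<open>Cauchy w\<close>, of "e / (\<bar>C\<bar> + 1)"] by auto
      have "dist (f m) (f n) < e" if "N \<le> m" "N \<le> n" for m n
      proof -
        have "norm (f m - f n) \<le> (\<bar>C\<bar> + 1) * norm (w m - w n)"
          using le[of m n] by (rule order_trans) (intro mult_right_mono, auto)
        also have "\<dots> < e" using N that by (auto simp: dist_norm field_simps)
        finally show ?thesis by (simp add: dist_norm)
      qed
      then show "\<exists>M. \<forall>m\<ge>M. \<forall>n\<ge>M. dist (f m) (f n) < e" by blast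
    qed
    then obtain l where l: "f \<longlonglongrightarrow> l" by (auto simp: Cauchy_convergent_iff convergent_def)
    have "(\<lambda>n. (f n, w n + \<mu> *\<^sub>R f n)) \<longlonglongrightarrow> (l, x + \<mu> *\<^sub>R l)"
      by (intro tendsto_intros l wx)
    from closed_sequentially[OF self_adjoint_closed[OF sa] f this]
    have "(l, x + \<mu> *\<^sub>R l) \<in> A" .
    then show "x \<in> M" unfolding M_iff by blast
  qed
  moreover have "closure M = UNIV"
  proof (rule dense_subspaceI[OF M])
    fix h assume h: "\<And>m. m \<in> M \<Longrightarrow> inner h m = 0"
    have "inner g h = inner f (\<mu> *\<^sub>R h)" if "(f, g) \<in> A" for f g
    proof -
      have "g - \<mu> *\<^sub>R f \<in> M" unfolding M_iff using that by (intro exI[of _ f]) simp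
      from h[OF this] show ?thesis by (simp add: inner_diff_right inner_commute)
    qed
    then have "(h, \<mu> *\<^sub>R h) \<in> operator_adjoint A" by (auto simp: operator_adjoint_def)
    then have "(h, \<mu> *\<^sub>R h) \<in> A" using sa by (simp add: self_adjoint_def)
    from C[OF this] show "h = 0" by simp
  qed
  ultimately have "M = UNIV" by (simp add: closure_closed)
  then obtain R where R: "\<And>h. (R h, h + \<mu> *\<^sub>R R h) \<in> A"
    unfolding set_eq_iff M_iff by simp metis
  have "bounded_linear R"
  proof (rule bounded_linear_intro)
    show "R (x + y) = R x + R y" for x y
      using subspace_add[OF A R[of x] R[of y]] by (intro inj[OF R]) (simp add: algebra_simps)
    show "R (t *\<^sub>R x) = t *\<^sub>R R x" for t x
      using subspace_scale[OF A R[of x], of t] by (intro inj[OF R]) (simp add: algebra_simps)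
    show "norm (R x) \<le> norm x * C" for x using C[OF R[of x]] by (simp add: mult.commute)
  qed
  moreover have "(operator_shift A \<mu>)\<inverse> = {(h, R h) | h. True}"
  proof (intro equalityI subrelI)
    fix h f assume "(h, f) \<in> (operator_shift A \<mu>)\<inverse>"
    then have "(f, h + \<mu> *\<^sub>R f) \<in> A" by (auto simp: operator_shift_def)
    then have "f = R h" using R by (rule inj)
    then show "(h, f) \<in> {(h, R h) | h. True}" by simp
  next
    fix h f assume "(h, f) \<in> {(h, R h) | h. True}"
    then show "(h, f) \<in> (operator_shift A \<mu>)\<inverse>"
      using R[of h] by (auto simp: operator_shift_def intro!: exI[of _ "h + \<mu> *\<^sub>R R h"])
  qed
  ultimately show ?thesis by (auto simp: resolvent_set_def)
qed

text \<open>With a trivial eigenspace the orthogonality condition is vacuous and the coercive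
  estimate holds on the whole domain.\<close>

lemma eigenvalue_if_spectrum:
  fixes A :: "('h::{real_inner,complete_space} \<times> 'h) set"
  assumes sa: "self_adjoint A" and comp: "compact_domain A" and "\<mu> \<in> spectrum A"
  shows "eigenvalue A \<mu>"
proof (rule ccontr)
  assume "\<not> ?thesis"
  then have "\<forall>e\<in>eigenspace A \<mu>. inner f e = 0" for f by (auto simp: eigenvalue_def)
  then obtain C where "\<And>f g. (f, g) \<in> A \<Longrightarrow> norm f \<le> C * norm (g - \<mu> *\<^sub>R f)"
    using coercive_on_eigenspace_complement[OF sa comp, of \<mu>] by blast
  then show False using resolvent_if_coercive[OF sa] assms(3) by (auto simp: spectrum_def)
qed

text \<open>A second spectral value \<nu> is an eigenvalue with eigenvectors orthogonal to the
  eigenspace at \<mu>. The coercive estimate for such a vector reads 1 \<le> C * \<bar>\<nu> -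
  \<mu>\<bar>, so the ball of radius 1 / C isolates \<mu>.\<close>

theorem essential_spectrum_empty_if_compact_domain:
  fixes A :: "('h::{real_inner,complete_space} \<times> 'h) set"
  assumes sa: "self_adjoint A" and comp: "compact_domain A"
  shows "essential_spectrum A = {}"
proof -
  have "\<mu> isolated_in spectrum A" if \<mu>: "\<mu> \<in> spectrum A" for \<mu>
  proof -
    obtain C where C0: "C > 0" and C: "\<And>f g. (f, g) \<in> A \<Longrightarrow> (\<And>e. e \<in> eigenspace A \<mu> \<Longrightarrow> inner f e = 0) \<Longrightarrow>
        norm f \<le> C * norm (g - \<mu> *\<^sub>R f)"
      using coercive_on_eigenspace_complement[OF sa comp, of \<mu>] by blast
    have "\<nu> = \<mu>" if \<nu>: "\<nu> \<in> spectrum A" "\<nu> \<in> ball \<mu> (1 / C)" for \<nu>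
    proof (rule ccontr)
      assume ne: "\<nu> \<noteq> \<mu>"
      obtain f where f: "(f, \<nu> *\<^sub>R f) \<in> A" "f \<noteq> 0"
        using eigenvalue_if_spectrum[OF sa comp \<nu>(1)] by (auto simp: eigenvalue_def eigenspace_def)
      have "inner f e = 0" if "e \<in> eigenspace A \<mu>" for e
        using self_adjoint_symmetric[OF sa f(1), of e "\<mu> *\<^sub>R e"] that ne
        by (simp add: eigenspace_def)
      then have "norm f \<le> C * norm (\<nu> *\<^sub>R f - \<mu> *\<^sub>R f)" by (rule C[OF f(1)])
      also have "\<dots> = C * \<bar>\<nu> - \<mu>\<bar> * norm f" by (simp flip: scaleR_diff_left)
      finally have "1 \<le> C * \<bar>\<nu> - \<mu>\<bar>" using f(2) by simp
      moreover have "\<bar>\<nu> - \<mu>\<bar> < 1 / C" using \<nu>(2) by (simp add: dist_real_def abs_minus_commute)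
      then have "\<bar>\<nu> - \<mu>\<bar> * C < 1" using C0 by (simp only: pos_less_divide_eq)
      ultimately show False by (simp add: mult.commute)
    qed
    then have "ball \<mu> (1 / C) \<inter> spectrum A = {\<mu>}" using \<mu> C0 by auto
    then show ?thesis unfolding isolated_in_def using \<mu> by blast
  qed
  then show ?thesis
    using eigenvalue_if_spectrum[OF sa comp] finite_multiplicity_if_compact_domain[OF sa comp]
    by (auto simp: essential_spectrum_def)
qed

section \<open>The space of square summable functions\<close>

lemma ell2_fun_diff: "ell2_fun (f - g) x = ell2_fun f x - ell2_fun g x"
  unfolding minus_ell2_def plus_ell2.rep_eq uminus_ell2.rep_eq by simp

lemma norm_ell2_power2: "(norm f)\<^sup>2 = (\<Sum>\<^sub>\<infinity>x. (ell2_fun f x)\<^sup>2)"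
  by (simp only: power2_norm_eq_inner inner_ell2.rep_eq) (simp only: power2_eq_square)

lemma ell2_fun_summable: "(\<lambda>x. (ell2_fun f x)\<^sup>2) summable_on UNIV"
  using ell2_fun[of f] by simp

lemma sum_power2_le_norm:
  "finite F \<Longrightarrow> (\<Sum>x\<in>F. (ell2_fun f x)\<^sup>2) \<le> (norm f)\<^sup>2"
  unfolding norm_ell2_power2 by (rule finite_sum_le_infsum[OF ell2_fun_summable]) auto

text \<open>Together with \<open>sum_power2_le_norm\<close> this reduces norm estimates to finite
  sums, through which pointwise limits pass freely.\<close>

lemma norm_power2_le_sums:
  assumes "\<And>F. finite F \<Longrightarrow> (\<Sum>x\<in>F. (ell2_fun f x)\<^sup>2) \<le> B"
  shows "(norm f)\<^sup>2 \<le> B"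
  unfolding norm_ell2_power2 using assms by (intro infsum_le_finite_sums ell2_fun_summable) auto

lemma abs_ell2_fun_le_norm: "\<bar>ell2_fun f x\<bar> \<le> norm f"
  by (rule power2_le_imp_le) (use sum_power2_le_norm[of "{x}" f] in simp_all)

lemma inner_ell2_finite:
  assumes "finite U" and "\<And>x. x \<notin> U \<Longrightarrow> ell2_fun f x * ell2_fun g x = 0"
  shows "inner f g = (\<Sum>x\<in>U. ell2_fun f x * ell2_fun g x)"
proof -
  have "inner f g = (\<Sum>\<^sub>\<infinity>x\<in>U. ell2_fun f x * ell2_fun g x)"
    unfolding inner_ell2.rep_eq using assms(2) by (intro infsum_cong_neutral) auto
  then show ?thesis using assms(1) by simp
qed

lemma ell2_of_bounded_sums:
  assumes "\<And>F. finite F \<Longrightarrow> (\<Sum>x\<in>F. (u x)\<^sup>2) \<le> B"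
  obtains f where "ell2_fun f = u"
proof -
  have "(\<lambda>x. (u x)\<^sup>2) summable_on UNIV"
    using assms by (intro nonneg_bdd_above_summable_on bdd_aboveI[of _ B]) auto
  then show ?thesis using that[of "Abs_ell2 u"] by (simp add: Abs_ell2_inverse)
qed

text \<open>The limit is taken coordinatewise; the Cauchy bound on each finite set survives the
  limit in the second index, uniformly in the set.\<close>

instance ell2 :: (type) complete_space
proof
  fix X :: "nat \<Rightarrow> 'a ell2"
  assume X: "Cauchy X"
  have "Cauchy (\<lambda>n. ell2_fun (X n) x)" for x
  proof (rule metric_CauchyI)
    fix e :: real assume "0 < e"
    then obtain M where "\<forall>m\<ge>M. \<forall>n\<ge>M. dist (X m) (X n) < e" using metric_CauchyD[OF X] by blast
    then show "\<exists>M. \<forall>m\<ge>M. \<forall>n\<ge>M. dist (ell2_fun (X m) x) (ell2_fun (X n) x) < e"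
      unfolding dist_norm real_norm_def ell2_fun_diff[symmetric]
      by (meson abs_ell2_fun_le_norm le_less_trans)
  qed
  then have "\<forall>x. \<exists>l. (\<lambda>n. ell2_fun (X n) x) \<longlonglongrightarrow> l"
    by (simp add: Cauchy_convergent_iff convergent_def)
  then obtain l where l: "\<And>x. (\<lambda>n. ell2_fun (X n) x) \<longlonglongrightarrow> l x" by metis
  have close: "\<exists>N. \<forall>m\<ge>N. \<forall>F. finite F \<longrightarrow> (\<Sum>x\<in>F. (ell2_fun (X m) x - l x)\<^sup>2) \<le> e\<^sup>2" if "0 < e" for e
  proof -
    obtain N where N: "\<forall>m\<ge>N. \<forall>n\<ge>N. dist (X m) (X n) < e" using metric_CauchyD[OF X \<open>0 < e\<close>] by blast
    have "(\<Sum>x\<in>F. (ell2_fun (X m) x - l x)\<^sup>2) \<le> e\<^sup>2" if "N \<le> m" "finite F" for m F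
    proof (rule LIMSEQ_le_const2)
      show "(\<lambda>n. \<Sum>x\<in>F. (ell2_fun (X m) x - ell2_fun (X n) x)\<^sup>2) \<longlonglongrightarrow> (\<Sum>x\<in>F. (ell2_fun (X m) x - l x)\<^sup>2)"
        by (intro tendsto_intros l)
      have "(\<Sum>x\<in>F. (ell2_fun (X m) x - ell2_fun (X n) x)\<^sup>2) \<le> e\<^sup>2" if "N \<le> n" for n
      proof -
        have "(\<Sum>x\<in>F. (ell2_fun (X m) x - ell2_fun (X n) x)\<^sup>2) \<le> (norm (X m - X n))\<^sup>2"
          using sum_power2_le_norm[OF \<open>finite F\<close>, of "X m - X n"] by (simp add: ell2_fun_diff)
        also have "\<dots> \<le> e\<^sup>2"
          using N that \<open>N \<le> m\<close> by (intro power_mono) (auto simp: dist_norm intro: less_imp_le)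
        finally show ?thesis .
      qed
      then show "\<exists>N. \<forall>n\<ge>N. (\<Sum>x\<in>F. (ell2_fun (X m) x - ell2_fun (X n) x)\<^sup>2) \<le> e\<^sup>2" by blast
    qed
    then show ?thesis by blast
  qed
  obtain N where "\<forall>m\<ge>N. \<forall>F. finite F \<longrightarrow> (\<Sum>x\<in>F. (ell2_fun (X m) x - l x)\<^sup>2) \<le> 1\<^sup>2"
    using close[of 1] by auto
  then have "\<And>F. finite F \<Longrightarrow> (\<Sum>x\<in>F. (ell2_fun (X N) x - l x)\<^sup>2) \<le> 1\<^sup>2" by blast
  \<comment> \<open>The uniform bound controls \<open>X N\<close> minus the limit, not the limit
    itself, so the difference is placed in the space first and the limit recovered from it.\<close>
  then obtain d where d: "ell2_fun d = (\<lambda>x. ell2_fun (X N) x - l x)" by (rule ell2_of_bounded_sums)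
  define L where "L = X N - d"
  have L: "ell2_fun L x = l x" for x by (simp add: L_def ell2_fun_diff d)
  have "X \<longlonglongrightarrow> L"
  proof (rule metric_LIMSEQ_I)
    fix e :: real assume "0 < e"
    then obtain M where M: "\<forall>m\<ge>M. \<forall>F. finite F \<longrightarrow> (\<Sum>x\<in>F. (ell2_fun (X m) x - l x)\<^sup>2) \<le> (e / 2)\<^sup>2"
      using close[of "e / 2"] by auto
    have "dist (X m) L < e" if "M \<le> m" for m
    proof -
      have "\<And>F. finite F \<Longrightarrow> (\<Sum>x\<in>F. (ell2_fun (X m) x - l x)\<^sup>2) \<le> (e / 2)\<^sup>2" using M that by blast
      then have "(norm (X m - L))\<^sup>2 \<le> (e / 2)\<^sup>2"
        by (intro norm_power2_le_sums) (simp only: ell2_fun_diff L)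
      then have "norm (X m - L) \<le> e / 2" by (rule power2_le_imp_le) (use \<open>0 < e\<close> in simp)
      then show ?thesis using \<open>0 < e\<close> by (simp add: dist_norm)
    qed
    then show "\<exists>M. \<forall>m\<ge>M. dist (X m) L < e" by blast
  qed
  then show "convergent X" by (auto simp: convergent_def)
qed

definition ell2_delta :: "'v \<Rightarrow> 'v ell2" where
  "ell2_delta x = Abs_ell2 (\<lambda>y. if y = x then 1 else 0)"

lemma ell2_fun_delta: "ell2_fun (ell2_delta x) = (\<lambda>y. if y = x then 1 else 0)"
proof -
  have "(\<lambda>y. (if y = x then 1 else 0 :: real)\<^sup>2) summable_on UNIV"
    by (rule finite_nonzero_values_imp_summable_on) (rule finite_subset[of _ "{x}"], auto)
  then show ?thesis by (simp add: ell2_delta_def Abs_ell2_inverse)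
qed

text \<open>Point evaluation as an inner product is visibly continuous; the Hardy inequality passes
  to the closure in this form.\<close>

lemma inner_ell2_delta: "inner (ell2_delta x) f = ell2_fun f x"
proof -
  have "inner (ell2_delta x) f = (\<Sum>y\<in>{x}. ell2_fun (ell2_delta x) y * ell2_fun f y)"
    by (rule inner_ell2_finite) (simp_all add: ell2_fun_delta)
  then show ?thesis by (simp add: ell2_fun_delta)
qed

section \<open>The Laplacian of a locally finite graph\<close>

lemma laplacian_zero: "laplacian E (\<lambda>_. 0) x = 0"
  by (simp add: laplacian_def)

lemma laplacian_add: "laplacian E (\<lambda>x. f x + g x) x = laplacian E f x + laplacian E g x"
  by (simp add: laplacian_def sum.distrib[symmetric] algebra_simps)

lemma laplacian_scale: "laplacian E (\<lambda>x. t * f x) x = t * laplacian E f x"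
  by (simp add: laplacian_def sum_distrib_left right_diff_distrib)

lemma subspace_laplacian_fin: "subspace (laplacian_fin E)"
proof (rule subspaceI)
  show "0 \<in> laplacian_fin E"
    by (simp add: laplacian_fin_def zero_prod_def zero_ell2.rep_eq laplacian_zero fun_eq_iff)
next
  fix p q assume "p \<in> laplacian_fin E" "q \<in> laplacian_fin E"
  then have fin: "finite ({x. ell2_fun (fst p) x \<noteq> 0} \<union> {x. ell2_fun (fst q) x \<noteq> 0})"
    and *: "ell2_fun (snd p) = laplacian E (ell2_fun (fst p))"
      "ell2_fun (snd q) = laplacian E (ell2_fun (fst q))"
    by (auto simp: laplacian_fin_def)
  have "finite {x. ell2_fun (fst p + fst q) x \<noteq> 0}"
    by (rule finite_subset[OF _ fin]) (auto simp: plus_ell2.rep_eq)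
  moreover have "ell2_fun (snd p + snd q) = laplacian E (ell2_fun (fst p + fst q))"
    by (simp add: plus_ell2.rep_eq laplacian_add fun_eq_iff *)
  ultimately show "p + q \<in> laplacian_fin E"
    by (simp add: laplacian_fin_def plus_prod_def)
next
  fix t p assume "p \<in> laplacian_fin E"
  then have fin: "finite {x. ell2_fun (fst p) x \<noteq> 0}"
    and *: "ell2_fun (snd p) = laplacian E (ell2_fun (fst p))"
    by (auto simp: laplacian_fin_def)
  have "finite {x. ell2_fun (t *\<^sub>R fst p) x \<noteq> 0}"
    by (rule finite_subset[OF _ fin]) (auto simp: scaleR_ell2.rep_eq)
  moreover have "ell2_fun (t *\<^sub>R snd p) = laplacian E (ell2_fun (t *\<^sub>R fst p))"
    by (simp add: scaleR_ell2.rep_eq laplacian_scale fun_eq_iff *)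
  ultimately show "t *\<^sub>R p \<in> laplacian_fin E"
    by (simp add: laplacian_fin_def scaleR_prod_def)
qed

locale locally_finite_simple_graph =
  fixes E :: "('v \<times> 'v) set"
  assumes simple: "simple_graph E" and locfin: "locally_finite_graph E"
begin

lemma finite_neighbours [simp]: "finite (E `` {x})"
  using locfin by (simp add: locally_finite_graph_def)

lemma adj_sym: "(x, y) \<in> E \<Longrightarrow> (y, x) \<in> E"
  using simple by (auto simp: simple_graph_def dest: symD)

lemma adj_irrefl: "(x, x) \<notin> E"
  using simple by (auto simp: simple_graph_def irrefl_def)

text \<open>
  Sums over oriented edges are taken over a finite set that is closed under reversal, so that they
  can be symmetrised.
\<close>

definition edges_at :: "'v set \<Rightarrow> ('v \<times> 'v) set" where
  "edges_at U = {(x, y) \<in> E. x \<in> U \<or> y \<in> U}"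

lemma finite_edges_at: "finite U \<Longrightarrow> finite (edges_at U)"
proof -
  assume U: "finite U"
  then have S: "finite (Sigma U (\<lambda>x. E `` {x}))" by simp
  have "edges_at U \<subseteq> Sigma U (\<lambda>x. E `` {x}) \<union> prod.swap ` Sigma U (\<lambda>x. E `` {x})"
    by (auto simp: edges_at_def dest: adj_sym)
  then show ?thesis using S by (meson finite_UnI finite_imageI finite_subset)
qed

lemma sum_edges_at_swap:
  "(\<Sum>(x, y)\<in>edges_at U. F x y) = (\<Sum>(x, y)\<in>edges_at U. F y x)"
  by (rule sum.reindex_bij_witness[of _ prod.swap prod.swap])
    (auto simp: edges_at_def dest: adj_sym)

lemma sum_edges_at:
  fixes F :: "'v \<Rightarrow> 'v \<Rightarrow> real"
  assumes U: "finite U" and F: "\<And>x y. x \<notin> U \<Longrightarrow> F x y = 0"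
  shows "(\<Sum>(x, y)\<in>edges_at U. F x y) = (\<Sum>x\<in>U. \<Sum>y\<in>E `` {x}. F x y)"
proof -
  have "(\<Sum>(x, y)\<in>edges_at U. F x y) = (\<Sum>(x, y)\<in>Sigma U (\<lambda>x. E `` {x}). F x y)"
    using finite_edges_at[OF U] by (rule sum.mono_neutral_right) (use F in \<open>auto simp: edges_at_def\<close>)
  also have "\<dots> = (\<Sum>x\<in>U. \<Sum>y\<in>E `` {x}. F x y)"
    by (rule sum.Sigma[symmetric]) (auto simp: U)
  finally show ?thesis .
qed

text \<open>Every edge occurs in both orientations, hence the factor 2. \<open>U\<close> contains
  both supports, so that \<open>f\<close> and \<open>g\<close> enter alike and the formula can be
  read with their roles exchanged.\<close>

lemma green_formula:
  assumes fk: "(f, k) \<in> laplacian_fin E" and U: "finite U"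
    and f: "\<And>x. x \<notin> U \<Longrightarrow> ell2_fun f x = 0" and g: "\<And>x. x \<notin> U \<Longrightarrow> ell2_fun g x = 0"
  shows "2 * inner k g =
    (\<Sum>(x, y)\<in>edges_at U. (ell2_fun f x - ell2_fun f y) * (ell2_fun g x - ell2_fun g y))"
proof -
  let ?f = "ell2_fun f" and ?g = "ell2_fun g"
  have "inner k g = (\<Sum>x\<in>U. ell2_fun k x * ?g x)"
    using U g by (intro inner_ell2_finite) auto
  also have "\<dots> = (\<Sum>x\<in>U. \<Sum>y\<in>E `` {x}. (?f x - ?f y) * ?g x)"
    using fk by (simp add: laplacian_fin_def laplacian_def sum_distrib_right)
  also have "\<dots> = (\<Sum>(x, y)\<in>edges_at U. (?f x - ?f y) * ?g x)"
    by (rule sum_edges_at[symmetric]) (auto simp: U g)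
  finally have 1: "inner k g = (\<Sum>(x, y)\<in>edges_at U. (?f x - ?f y) * ?g x)" .
  also have "\<dots> = (\<Sum>(x, y)\<in>edges_at U. (?f y - ?f x) * ?g y)"
    by (rule sum_edges_at_swap)
  finally have 2: "inner k g = (\<Sum>(x, y)\<in>edges_at U. (?f y - ?f x) * ?g y)" .
  have "2 * inner k g = (\<Sum>(x, y)\<in>edges_at U. (?f x - ?f y) * ?g x) + (\<Sum>(x, y)\<in>edges_at U. (?f y - ?f x) * ?g y)"
    using 1 2 by linarith
  also have "\<dots> = (\<Sum>(x, y)\<in>edges_at U. (?f x - ?f y) * (?g x - ?g y))"
    unfolding sum.distrib[symmetric] by (rule sum.cong) (auto simp: algebra_simps)
  finally show ?thesis .
qed

lemma laplacian_fin_symmetric: "laplacian_fin E \<subseteq> operator_adjoint (laplacian_fin E)"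
proof (rule subrelI)
  fix g h assume gh: "(g, h) \<in> laplacian_fin E"
  have "inner k g = inner f h" if fk: "(f, k) \<in> laplacian_fin E" for f k
  proof -
    let ?U = "{x. ell2_fun f x \<noteq> 0} \<union> {x. ell2_fun g x \<noteq> 0}"
    have U: "finite ?U" using gh fk by (auto simp: laplacian_fin_def)
    have "2 * inner k g = (\<Sum>(x, y)\<in>edges_at ?U.
        (ell2_fun f x - ell2_fun f y) * (ell2_fun g x - ell2_fun g y))"
      by (rule green_formula[OF fk U]) auto
    also have "\<dots> = (\<Sum>(x, y)\<in>edges_at ?U.
        (ell2_fun g x - ell2_fun g y) * (ell2_fun f x - ell2_fun f y))"
      by (simp only: mult.commute)
    also have "\<dots> = 2 * inner h f" by (rule green_formula[OF gh U, symmetric]) auto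
    finally show ?thesis by (simp add: inner_commute)
  qed
  then show "(g, h) \<in> operator_adjoint (laplacian_fin E)" by (auto simp: operator_adjoint_def)
qed

lemma laplacian_fin_nonneg:
  assumes "(f, k) \<in> laplacian_fin E"
  shows "0 \<le> inner f k"
proof -
  have "2 * inner k f = (\<Sum>(x, y)\<in>edges_at {x. ell2_fun f x \<noteq> 0}.
      (ell2_fun f x - ell2_fun f y) * (ell2_fun f x - ell2_fun f y))"
    using assms by (intro green_formula) (auto simp: laplacian_fin_def)
  also have "\<dots> \<ge> 0" by (rule sum_nonneg) auto
  finally show ?thesis by (simp add: inner_commute)
qed

lemma delta_in_Domain: "ell2_delta x \<in> Domain (laplacian_fin E)"
proof -
  have "{y. ell2_fun (ell2_delta x) y \<noteq> 0} = {x}" by (auto simp: ell2_fun_delta)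
  then show ?thesis unfolding Domain_laplacian_fin[OF simple locfin] by simp
qed

section \<open>Essential self-adjointness of the finitely supported Laplacian\<close>

lemma closure_Domain_laplacian_fin: "closure (Domain (laplacian_fin E)) = UNIV"
proof (rule dense_subspaceI)
  have "Domain (laplacian_fin E) = fst ` laplacian_fin E" by (rule Domain_fst)
  then show "subspace (Domain (laplacian_fin E))"
    using linear_subspace_image[OF linear_fst subspace_laplacian_fin] by simp
  fix h assume "\<And>m. m \<in> Domain (laplacian_fin E) \<Longrightarrow> inner h m = 0"
  then have "inner (ell2_delta x) h = 0" for x
    by (metis delta_in_Domain inner_commute)
  then have "ell2_fun h = ell2_fun 0" by (simp add: inner_ell2_delta zero_ell2.rep_eq fun_eq_iff)
  then show "h = 0" by (simp only: ell2_fun_inject)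
qed

text \<open>The adjoint relation is tested against the delta function at \<open>x\<close>, whose
  Laplacian is the valence at \<open>x\<close>, -1 at the neighbours and 0 elsewhere.\<close>

lemma adjoint_laplacian_fin_pointwise:
  assumes "(h, k) \<in> operator_adjoint (laplacian_fin E)"
  shows "ell2_fun k x = laplacian E (ell2_fun h) x"
proof -
  obtain d where d: "(ell2_delta x, d) \<in> laplacian_fin E" using delta_in_Domain by blast
  then have dl: "ell2_fun d = laplacian E (\<lambda>y. if y = x then 1 else 0)"
    by (simp add: laplacian_fin_def ell2_fun_delta)
  have dx: "ell2_fun d x = real (card (E `` {x}))"
  proof -
    have "laplacian E (\<lambda>y. if y = x then 1 else 0) x = (\<Sum>y\<in>E `` {x}. 1)"
      unfolding laplacian_def by (rule sum.cong) (auto simp: adj_irrefl)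
    then show ?thesis by (simp add: dl)
  qed
  have dy: "ell2_fun d y = (if y \<in> E `` {x} then - 1 else 0)" if "y \<noteq> x" for y
  proof -
    have "ell2_fun d y = (\<Sum>z\<in>E `` {y}. if z = x then - 1 else 0)"
      unfolding dl laplacian_def using that by (intro sum.cong) auto
    also have "\<dots> = (if x \<in> E `` {y} then - 1 else 0)" by simp
    finally show ?thesis using adj_sym by auto
  qed
  have x: "x \<notin> E `` {x}" using adj_irrefl by simp
  have "ell2_fun k x = inner d h"
    using assms d by (auto simp: operator_adjoint_def inner_ell2_delta[symmetric])
  also have "\<dots> = (\<Sum>y\<in>insert x (E `` {x}). ell2_fun d y * ell2_fun h y)"
    by (rule inner_ell2_finite) (auto simp: dy)
  also have "\<dots> = real (card (E `` {x})) * ell2_fun h x + (\<Sum>y\<in>E `` {x}. ell2_fun d y * ell2_fun h y)"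
    using x by (simp add: dx)
  also have "(\<Sum>y\<in>E `` {x}. ell2_fun d y * ell2_fun h y) = (\<Sum>y\<in>E `` {x}. - ell2_fun h y)"
  proof (rule sum.cong)
    fix y assume y: "y \<in> E `` {x}"
    then have "y \<noteq> x" using x by blast
    from dy[OF this] show "ell2_fun d y * ell2_fun h y = - ell2_fun h y" using y by simp
  qed simp
  also have "real (card (E `` {x})) * ell2_fun h x + \<dots> = laplacian E (ell2_fun h) x"
    by (simp add: laplacian_def sum_subtractf sum_negf)
  finally show ?thesis .
qed

text \<open>A square summable function attains its maximum if it is positive somewhere.\<close>

lemma maximum_principle:
  assumes "\<And>x. laplacian E (ell2_fun h) x = - ell2_fun h x"
  shows "ell2_fun h z \<le> 0"
proof (rule ccontr)
  let ?h = "ell2_fun h"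
  assume "\<not> ?thesis"
  then have z: "?h z > 0" by simp
  define S where "S = {x. ?h z \<le> ?h x}"
  \<comment> \<open>Chebyshev's inequality: few points can carry values at least
    \<open>?h z > 0\<close>, so the maximum is taken over a finite set.\<close>
  have "card G \<le> nat \<lceil>(norm h)\<^sup>2 / (?h z)\<^sup>2\<rceil>" if G: "G \<subseteq> S" "finite G" for G
  proof -
    have "real (card G) * (?h z)\<^sup>2 = (\<Sum>x\<in>G. (?h z)\<^sup>2)" by simp
    also have "\<dots> \<le> (\<Sum>x\<in>G. (?h x)\<^sup>2)"
      using G z by (intro sum_mono power_mono) (auto simp: S_def)
    also have "\<dots> \<le> (norm h)\<^sup>2" by (rule sum_power2_le_norm) (rule G)
    finally have "real (card G) \<le> (norm h)\<^sup>2 / (?h z)\<^sup>2" using z by (simp add: pos_le_divide_eq)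
    then show ?thesis by linarith
  qed
  then have "finite S" using finite_if_finite_subsets_card_bdd by blast
  moreover have "S \<noteq> {}" by (auto simp: S_def)
  ultimately have "Max (?h ` S) \<in> ?h ` S" by (intro Max_in) auto
  then obtain x where x: "x \<in> S" "?h x = Max (?h ` S)" by auto
  have max: "?h y \<le> ?h x" if "y \<in> S" for y
    unfolding x(2) using \<open>finite S\<close> that by (intro Max_ge) auto
  have "?h y \<le> ?h x" for y
    using x(1) max[of y] by (cases "y \<in> S") (auto simp: S_def)
  \<comment> \<open>At a maximum every difference in the Laplacian is nonnegative, whereas the
    equation makes their sum negative.\<close>
  then have "0 \<le> laplacian E ?h x" unfolding laplacian_def by (intro sum_nonneg) simp
  moreover have "?h x > 0" using x(1) z by (simp add: S_def)
  ultimately show False using assms[of x] by simp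
qed

text \<open>The maximum principle bounds only from above, so it is applied to \<open>h\<close> and
  to \<open>- h\<close>.\<close>

lemma adjoint_laplacian_fin_kernel:
  assumes "(h, - h) \<in> operator_adjoint (laplacian_fin E)"
  shows "h = 0"
proof -
  have le: "ell2_fun h x \<le> 0" for x
    by (rule maximum_principle)
      (simp add: adjoint_laplacian_fin_pointwise[OF assms, symmetric] uminus_ell2.rep_eq)
  have "(- h, - (- h)) \<in> operator_adjoint (laplacian_fin E)"
    using subspace_scale[OF subspace_operator_adjoint assms, of "-1"] by simp
  note neg = adjoint_laplacian_fin_pointwise[OF this]
  have ge: "ell2_fun (- h) x \<le> 0" for x
    by (rule maximum_principle) (subst neg[symmetric], simp add: uminus_ell2.rep_eq)
  have "ell2_fun h x = 0" for x using le[of x] ge[of x] by (simp add: uminus_ell2.rep_eq)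
  then have "ell2_fun h = ell2_fun 0" by (simp add: zero_ell2.rep_eq fun_eq_iff)
  then show ?thesis by (simp only: ell2_fun_inject)
qed

lemma adjoint_laplacian_fin_eq_closure:
  "operator_adjoint (laplacian_fin E) = closure (laplacian_fin E)"
  by (rule operator_adjoint_eq_closure[OF subspace_laplacian_fin laplacian_fin_symmetric
        laplacian_fin_nonneg adjoint_laplacian_fin_kernel])

lemma self_adjoint_closure_laplacian_fin: "self_adjoint (closure (laplacian_fin E))"
  using self_adjoint_operator_adjoint[OF closure_Domain_laplacian_fin laplacian_fin_symmetric
      adjoint_laplacian_fin_eq_closure]
  by (simp add: adjoint_laplacian_fin_eq_closure)

lemma laplacian_sa_eq_closure: "laplacian_sa E = closure (laplacian_fin E)"
  unfolding laplacian_sa_def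
proof (rule the_equality)
  show "self_adjoint (closure (laplacian_fin E)) \<and> laplacian_fin E \<subseteq> closure (laplacian_fin E)"
    using self_adjoint_closure_laplacian_fin closure_subset by blast
  show "A = closure (laplacian_fin E)" if "self_adjoint A \<and> laplacian_fin E \<subseteq> A" for A
    using self_adjoint_extension_unique[of "laplacian_fin E" A] that self_adjoint_closure_laplacian_fin
    by (simp add: adjoint_laplacian_fin_eq_closure)
qed

end

section \<open>A weighted Hardy inequality and compactness\<close>

text \<open>AM-GM for \<bar>a - b\<bar> / c and \<bar>a + b\<bar> / 2. The weight c / 2 is chosen so
  that, summed over oriented edges, the mass term is half of what the radial hypothesis
  provides.\<close>

lemma abs_diff_power2_le:
  fixes a b c :: real
  assumes "c > 0"
  shows "\<bar>a\<^sup>2 - b\<^sup>2\<bar> \<le> (a - b)\<^sup>2 / c + c / 2 * (a\<^sup>2 + b\<^sup>2)"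
proof -
  have "0 \<le> (\<bar>a - b\<bar> / c - \<bar>a + b\<bar> / 2)\<^sup>2" by simp
  then have "2 * (\<bar>a - b\<bar> / c) * (\<bar>a + b\<bar> / 2) \<le> (\<bar>a - b\<bar> / c)\<^sup>2 + (\<bar>a + b\<bar> / 2)\<^sup>2"
    by (simp only: power2_diff)
  then have "\<bar>a - b\<bar> * \<bar>a + b\<bar> / c \<le> (a - b)\<^sup>2 / c\<^sup>2 + (a + b)\<^sup>2 / 4"
    by (simp add: power_divide)
  then have "c * (\<bar>a - b\<bar> * \<bar>a + b\<bar> / c) \<le> c * ((a - b)\<^sup>2 / c\<^sup>2 + (a + b)\<^sup>2 / 4)"
    using assms by (intro mult_left_mono) auto
  moreover have "c * (\<bar>a - b\<bar> * \<bar>a + b\<bar> / c) = \<bar>a\<^sup>2 - b\<^sup>2\<bar>"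
    using assms by (simp add: abs_mult[symmetric] power2_eq_square algebra_simps)
  moreover have "c * ((a - b)\<^sup>2 / c\<^sup>2 + (a + b)\<^sup>2 / 4) = (a - b)\<^sup>2 / c + c * ((a + b)\<^sup>2 / 4)"
    using assms by (simp add: distrib_left power2_eq_square)
  moreover have "(a + b)\<^sup>2 / 4 \<le> (a\<^sup>2 + b\<^sup>2) / 2"
    using zero_le_power2[of "a - b"] by (simp add: power2_diff power2_sum field_simps)
  then have "c * ((a + b)\<^sup>2 / 4) \<le> c * ((a\<^sup>2 + b\<^sup>2) / 2)" using assms by (intro mult_left_mono) auto
  ultimately show ?thesis by simp
qed

context locally_finite_simple_graph
begin

text \<open>A discrete radial derivative of the distance, antisymmetric in \<open>x\<close> and
  \<open>y\<close>. Built from indicators it is bounded by 1 in absolute value for any two vertices,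
  with no appeal to how distances vary along edges.\<close>

definition radial_sign :: "'v \<Rightarrow> 'v \<Rightarrow> 'v \<Rightarrow> real" where
  "radial_sign x0 x y =
     of_bool (graph_dist E y x0 = graph_dist E x x0 + 1) -
     of_bool (graph_dist E y x0 + 1 = graph_dist E x x0)"

lemma radial_sign_le: "radial_sign x0 x y * t \<le> \<bar>t\<bar>"
  by (auto simp: radial_sign_def)

lemma sum_radial_sign:
  "(\<Sum>y\<in>E `` {x}. radial_sign x0 x y) = real (outer_valence E x0 x) - real (inner_valence E x0 x)"
proof -
  have *: "(\<Sum>y\<in>E `` {x}. of_bool (P y)) = real (card {y \<in> E `` {x}. P y})" for P
    by (simp add: of_bool_def sum.If_cases Int_def)
  show ?thesis
    unfolding radial_sign_def sum_subtractf * outer_valence_def inner_valence_def by simp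
qed

text \<open>
  Summation by parts turns the hypothesis on the radial valences into a weighted Hardy inequality;
  the factor \<open>(f x)\<^sup>2 - (f y)\<^sup>2\<close> is split by AM-GM, half of the mass term being absorbed.
\<close>

lemma hardy_laplacian_fin:
  assumes c: "c > 0"
    and radial: "\<And>x. c * real (valence E x) \<le> real (outer_valence E x0 x) - real (inner_valence E x0 x)"
    and fk: "(f, k) \<in> laplacian_fin E" and F: "finite F"
  shows "(\<Sum>x\<in>F. real (valence E x) * (ell2_fun f x)\<^sup>2) \<le> 2 / c\<^sup>2 * inner f k"
proof -
  let ?f = "ell2_fun f"
  define U where "U = {x. ?f x \<noteq> 0}"
  have U: "finite U" using fk by (simp add: U_def laplacian_fin_def)
  define M where "M = (\<Sum>x\<in>U. real (valence E x) * (?f x)\<^sup>2)"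
  define S where "S = (\<Sum>(x, y)\<in>edges_at U. radial_sign x0 x y * (?f x)\<^sup>2)"
  have f0: "?f x = 0" if "x \<notin> U" for x using that by (simp add: U_def)
  have M1: "(\<Sum>(x, y)\<in>edges_at U. (?f x)\<^sup>2) = M"
    unfolding M_def by (subst sum_edges_at) (auto simp: U f0 valence_def)
  then have M2: "(\<Sum>(x, y)\<in>edges_at U. (?f y)\<^sup>2) = M"
    using sum_edges_at_swap[of "\<lambda>x y. (?f x)\<^sup>2" U] by simp
  have D: "(\<Sum>(x, y)\<in>edges_at U. (?f x - ?f y)\<^sup>2) = 2 * inner f k"
    using green_formula[OF fk U f0 f0] by (simp add: inner_commute power2_eq_square)
  have "c * M \<le> (\<Sum>x\<in>U. (real (outer_valence E x0 x) - real (inner_valence E x0 x)) * (?f x)\<^sup>2)"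
    unfolding M_def sum_distrib_left
    using radial by (intro sum_mono) (simp add: mult_right_mono flip: mult.assoc)
  also have "\<dots> = S"
    unfolding S_def by (subst sum_edges_at) (auto simp: U f0 sum_radial_sign[symmetric] sum_distrib_right)
  finally have cM: "c * M \<le> S" .
  \<comment> \<open>Reversing the edges changes the sign of \<open>radial_sign\<close>; averaging
    both forms of \<open>S\<close> produces the differences of squares.\<close>
  have S': "S = (\<Sum>(x, y)\<in>edges_at U. - radial_sign x0 x y * (?f y)\<^sup>2)"
    unfolding S_def by (subst sum_edges_at_swap, rule sum.cong) (auto simp: radial_sign_def)
  have "2 * S = S + (\<Sum>(x, y)\<in>edges_at U. - radial_sign x0 x y * (?f y)\<^sup>2)"
    using S' by linarith
  also have "\<dots> = (\<Sum>(x, y)\<in>edges_at U. radial_sign x0 x y * ((?f x)\<^sup>2 - (?f y)\<^sup>2))"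
    unfolding S_def sum.distrib[symmetric] by (rule sum.cong) (auto simp: algebra_simps)
  also have "\<dots> \<le> (\<Sum>(x, y)\<in>edges_at U. (?f x - ?f y)\<^sup>2 / c + c / 2 * ((?f x)\<^sup>2 + (?f y)\<^sup>2))"
  proof (rule sum_mono)
    fix p assume "p \<in> edges_at U"
    obtain x y where p: "p = (x, y)" by (cases p)
    have "radial_sign x0 x y * ((?f x)\<^sup>2 - (?f y)\<^sup>2) \<le> (?f x - ?f y)\<^sup>2 / c + c / 2 * ((?f x)\<^sup>2 + (?f y)\<^sup>2)"
      using radial_sign_le abs_diff_power2_le[OF c] by (rule order_trans)
    then show "(case p of (x, y) \<Rightarrow> radial_sign x0 x y * ((?f x)\<^sup>2 - (?f y)\<^sup>2))
        \<le> (case p of (x, y) \<Rightarrow> (?f x - ?f y)\<^sup>2 / c + c / 2 * ((?f x)\<^sup>2 + (?f y)\<^sup>2))"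
      by (simp only: p case_prod_conv)
  qed
  also have "\<dots> = (\<Sum>(x, y)\<in>edges_at U. (?f x - ?f y)\<^sup>2) / c
      + c / 2 * ((\<Sum>(x, y)\<in>edges_at U. (?f x)\<^sup>2) + (\<Sum>(x, y)\<in>edges_at U. (?f y)\<^sup>2))"
    unfolding sum.distrib[symmetric] sum_divide_distrib sum_distrib_left by (rule sum.cong) auto
  also have "\<dots> = 2 * inner f k / c + c * M" unfolding M1 M2 D by simp
  \<comment> \<open>The left side \<open>2 * S\<close> is at least \<open>2 * (c * M)\<close>, so
    one copy of \<open>c * M\<close> remains after absorption.\<close>
  finally have "c * M \<le> 2 * inner f k / c" using cM by linarith
  then have "M \<le> 2 * inner f k / c / c" using c by (simp add: pos_le_divide_eq mult_ac)
  then have "M \<le> 2 / c\<^sup>2 * inner f k" by (simp add: power2_eq_square)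
  moreover have "(\<Sum>x\<in>F. real (valence E x) * (?f x)\<^sup>2) = (\<Sum>x\<in>F \<inter> U. real (valence E x) * (?f x)\<^sup>2)"
    by (rule sum.mono_neutral_right) (auto simp: F f0)
  moreover have "\<dots> \<le> M"
    unfolding M_def by (rule sum_mono2) (auto simp: U)
  ultimately show ?thesis by linarith
qed

text \<open>For a fixed finite \<open>F\<close> both sides are continuous in the pair (f, k), so the
  inequality is a closed condition on the graph.\<close>

lemma hardy_closure_laplacian_fin:
  assumes c: "c > 0"
    and radial: "\<And>x. c * real (valence E x) \<le> real (outer_valence E x0 x) - real (inner_valence E x0 x)"
    and fk: "(f, k) \<in> closure (laplacian_fin E)" and F: "finite F"
  shows "(\<Sum>x\<in>F. real (valence E x) * (ell2_fun f x)\<^sup>2) \<le> 2 / c\<^sup>2 * inner f k"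
proof -
  let ?C = "{p. (\<Sum>x\<in>F. real (valence E x) * (inner (ell2_delta x) (fst p))\<^sup>2) \<le> 2 / c\<^sup>2 * inner (fst p) (snd p)}"
  have "closed ?C" by (intro closed_Collect_le continuous_intros)
  moreover have "laplacian_fin E \<subseteq> ?C"
    using hardy_laplacian_fin[OF c radial _ F] by (auto simp: inner_ell2_delta)
  ultimately have "closure (laplacian_fin E) \<subseteq> ?C" by (intro closure_minimal)
  then have "(f, k) \<in> ?C" using fk by (rule subsetD)
  then show ?thesis by (simp only: mem_Collect_eq fst_conv snd_conv inner_ell2_delta)
qed

section \<open>Finiteness of the set of vertices of small valence\<close>

lemma finite_reachable: "finite {x. (x, x0) \<in> E ^^ n}"
proof (induction n)
  case (Suc n)
  have "{x. (x, x0) \<in> E ^^ Suc n} \<subseteq> (\<Union>y\<in>{y. (y, x0) \<in> E ^^ n}. E `` {y})"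
  proof
    fix x assume "x \<in> {x. (x, x0) \<in> E ^^ Suc n}"
    then obtain y where "(x, y) \<in> E" "(y, x0) \<in> E ^^ n" by (blast dest: relpow_Suc_D2)
    then show "x \<in> (\<Union>y\<in>{y. (y, x0) \<in> E ^^ n}. E `` {y})" using adj_sym by blast
  qed
  then show ?case by (rule finite_subset) (simp add: Suc)
qed simp

lemma finite_graph_sphere:
  assumes "connected_graph E"
  shows "finite (graph_sphere E x0 r)"
proof (rule finite_subset[OF _ finite_reachable])
  show "graph_sphere E x0 r \<subseteq> {x. (x, x0) \<in> E ^^ r}"
  proof
    fix x assume x: "x \<in> graph_sphere E x0 r"
    obtain n where "(x, x0) \<in> E ^^ n"
      using assms by (meson connected_graph_def rtrancl_power)
    then have "(x, x0) \<in> E ^^ graph_dist E x x0" unfolding graph_dist_def by (rule LeastI)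
    then show "x \<in> {x. (x, x0) \<in> E ^^ r}" using x by (simp add: graph_sphere_def)
  qed
qed

text \<open>Beyond some radius every sphere has minimal valence at least \<open>K\<close>, so these
  vertices lie in finitely many finite spheres.\<close>

lemma finite_small_valence:
  assumes conn: "connected_graph E" and lim: "filterlim (min_valence_sphere E x0) at_top at_top"
  shows "finite {x. valence E x < K}"
proof -
  obtain R where R: "\<And>r. R \<le> r \<Longrightarrow> K \<le> min_valence_sphere E x0 r"
    using lim by (auto simp: filterlim_at_top eventually_at_top_linorder)
  have "{x. valence E x < K} \<subseteq> (\<Union>r<R. graph_sphere E x0 r)"
  proof
    fix x assume x: "x \<in> {x. valence E x < K}"
    let ?r = "graph_dist E x x0"
    have "min_valence_sphere E x0 ?r \<le> valence E x"
      unfolding min_valence_sphere_def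
      by (intro Min_le finite_imageI finite_graph_sphere conn) (simp add: graph_sphere_def)
    then have "?r < R" using R[of ?r] x by (meson leD le_trans mem_Collect_eq not_le_imp_less)
    then show "x \<in> (\<Union>r<R. graph_sphere E x0 r)" by (simp add: graph_sphere_def)
  qed
  then show ?thesis by (rule finite_subset) (simp add: finite_graph_sphere conn)
qed

end

section \<open>Compactness from a weighted bound\<close>

lemma power2_diff_le:
  fixes a b l :: real
  shows "(a - b)\<^sup>2 \<le> 2 * (a - l)\<^sup>2 + 2 * (b - l)\<^sup>2"
  using zero_le_power2[of "a + b - 2 * l"] by (simp add: power2_eq_square algebra_simps)

text \<open>
  Uniform weighted bounds make the tails outside the finite set of vertices of small weight
  uniformly small, so that pointwise convergence along a subsequence is convergence in norm.
\<close>

lemma ell2_weighted_compact: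
  fixes f :: "nat \<Rightarrow> 'v ell2" and w :: "'v \<Rightarrow> nat"
  assumes w: "\<And>K. finite {x. w x < K}" and fK: "\<And>n. norm (f n) \<le> K"
    and B: "\<And>n F. finite F \<Longrightarrow> (\<Sum>x\<in>F. real (w x) * (ell2_fun (f n) x)\<^sup>2) \<le> B"
  shows "\<exists>l r. strict_mono (r :: nat \<Rightarrow> nat) \<and> (f \<circ> r) \<longlonglongrightarrow> l"
proof -
  \<comment> \<open>The finite sublevel sets of \<open>w\<close> exhaust the vertices; the resulting
    countability permits the diagonal choice of a subsequence.\<close>
  have "(UNIV :: 'v set) = (\<Union>K. {x. w x < K})" by auto
  then have "countable (UNIV :: 'v set)"
    using w by (metis countable_UN countable_finite countableI_type)
  moreover have "norm (ell2_fun (f n) x) \<le> K" for n x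
    using abs_ell2_fun_le_norm[of "f n" x] fK[of n] by simp
  ultimately obtain r where r: "strict_mono (r :: nat \<Rightarrow> nat)"
    and "\<And>x. x \<in> UNIV \<Longrightarrow> \<exists>l. (\<lambda>n. ell2_fun (f (r n)) x) \<longlonglongrightarrow> l"
    using function_convergent_subsequence[of UNIV "\<lambda>n. ell2_fun (f n)" K] by blast
  then obtain l where l: "\<And>x. (\<lambda>n. ell2_fun (f (r n)) x) \<longlonglongrightarrow> l x" by (metis UNIV_I)
  have B0: "0 \<le> B" using B[of "{}"] by simp
  have "Cauchy (f \<circ> r)"
  proof (rule metric_CauchyI)
    fix e :: real assume e: "0 < e"
    \<comment> \<open>The two tails contribute at most 4 B / V, which this choice makes less than
      e^2 / 2; the two terms \<open>b\<close> on the finite set supply the other half.\<close>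
    obtain V :: nat where V: "8 * B / e\<^sup>2 < real V" using reals_Archimedean2 by blast
    moreover have "0 \<le> 8 * B / e\<^sup>2" using B0 by simp
    ultimately have V0: "real V > 0" by linarith
    have BV: "4 * (B / real V) < e\<^sup>2 / 2"
      using V V0 e by (simp add: field_simps)
    define F where "F = {x. w x < V}"
    have F: "finite F" unfolding F_def by (rule w)
    define b where "b n = 2 * (\<Sum>x\<in>F. (ell2_fun (f (r n)) x - l x)\<^sup>2)" for n
    have "b \<longlonglongrightarrow> 2 * (\<Sum>x\<in>F. (l x - l x)\<^sup>2)"
      unfolding b_def by (intro tendsto_intros l)
    then have "b \<longlonglongrightarrow> 0" by simp
    then have "\<forall>\<^sub>F n in sequentially. b n < e\<^sup>2 / 4" using e by (intro order_tendstoD) auto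
    then obtain N where N: "\<And>n. n \<ge> N \<Longrightarrow> b n < e\<^sup>2 / 4" by (auto simp: eventually_sequentially)
    have tail: "(\<Sum>x\<in>G - F. (ell2_fun (f n) x)\<^sup>2) \<le> B / real V" if "finite G" for G n
    proof -
      have "real V * (\<Sum>x\<in>G - F. (ell2_fun (f n) x)\<^sup>2) \<le> (\<Sum>x\<in>G - F. real (w x) * (ell2_fun (f n) x)\<^sup>2)"
        unfolding sum_distrib_left by (intro sum_mono mult_right_mono) (auto simp: F_def)
      also have "\<dots> \<le> B" using that by (intro B) simp
      finally show ?thesis using V0 by (simp add: pos_le_divide_eq mult.commute)
    qed
    have "dist ((f \<circ> r) m) ((f \<circ> r) n) < e" if mn: "N \<le> m" "N \<le> n" for m n
    proof -
      have "(norm (f (r m) - f (r n)))\<^sup>2 \<le> b m + b n + 4 * (B / real V)"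
      proof (rule norm_power2_le_sums)
        fix G :: "'v set" assume G: "finite G"
        let ?u = "\<lambda>x. ell2_fun (f (r m)) x" and ?v = "\<lambda>x. ell2_fun (f (r n)) x"
        have "(\<Sum>x\<in>G \<inter> F. (?u x - ?v x)\<^sup>2) \<le> (\<Sum>x\<in>F. (?u x - ?v x)\<^sup>2)"
          by (rule sum_mono2) (auto simp: F)
        also have "\<dots> \<le> (\<Sum>x\<in>F. 2 * (?u x - l x)\<^sup>2 + 2 * (?v x - l x)\<^sup>2)"
          by (intro sum_mono power2_diff_le)
        also have "\<dots> = b m + b n" by (simp add: b_def sum.distrib sum_distrib_left)
        finally have 1: "(\<Sum>x\<in>G \<inter> F. (?u x - ?v x)\<^sup>2) \<le> b m + b n" .
        \<comment> \<open>On the tail the reference value is 0 instead of the pointwise limit, so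
          only the separate tail bounds are needed.\<close>
        have "(\<Sum>x\<in>G - F. (?u x - ?v x)\<^sup>2) \<le> (\<Sum>x\<in>G - F. 2 * (?u x - 0)\<^sup>2 + 2 * (?v x - 0)\<^sup>2)"
          by (intro sum_mono power2_diff_le)
        also have "\<dots> = 2 * (\<Sum>x\<in>G - F. (?u x)\<^sup>2) + 2 * (\<Sum>x\<in>G - F. (?v x)\<^sup>2)"
          by (simp add: sum.distrib sum_distrib_left)
        also have "\<dots> \<le> 4 * (B / real V)"
          using tail[OF G, of "r m"] tail[OF G, of "r n"] by linarith
        finally have 2: "(\<Sum>x\<in>G - F. (?u x - ?v x)\<^sup>2) \<le> 4 * (B / real V)" .
        have "(\<Sum>x\<in>G. (ell2_fun (f (r m) - f (r n)) x)\<^sup>2) =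
            (\<Sum>x\<in>G \<inter> F. (?u x - ?v x)\<^sup>2) + (\<Sum>x\<in>G - F. (?u x - ?v x)\<^sup>2)"
          unfolding ell2_fun_diff by (rule sum.Int_Diff[OF G])
        then show "(\<Sum>x\<in>G. (ell2_fun (f (r m) - f (r n)) x)\<^sup>2) \<le> b m + b n + 4 * (B / real V)"
          using 1 2 by linarith
      qed
      also have "\<dots> < e\<^sup>2" using N[OF mn(1)] N[OF mn(2)] BV by linarith
      finally have "norm (f (r m) - f (r n)) < e" using e by (intro power2_less_imp_less[of _ e]) auto
      then show ?thesis by (simp add: dist_norm)
    qed
    then show "\<exists>M. \<forall>m\<ge>M. \<forall>n\<ge>M. dist ((f \<circ> r) m) ((f \<circ> r) n) < e" by blast
  qed
  then obtain L where "(f \<circ> r) \<longlonglongrightarrow> L" unfolding Cauchy_convergent_iff convergent_def by blast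
  then show ?thesis using r by blast
qed

theorem theorem4p3p2:
  fixes E :: "('v \<times> 'v) set" and x0 :: 'v and c :: real
  assumes "simple_graph E" and "infinite (UNIV :: 'v set)"
    and "locally_finite_graph E" and "connected_graph E"
    and "c > 0"
    and "\<And>x. (real (outer_valence E x0 x) - real (inner_valence E x0 x)) / real (valence E x) \<ge> c"
    and "filterlim (min_valence_sphere E x0) at_top at_top"
  shows "essential_spectrum (laplacian_sa E) = {}"
proof -
  interpret locally_finite_simple_graph E
    by unfold_locales (rule assms)+
  have radial: "c * real (valence E x) \<le> real (outer_valence E x0 x) - real (inner_valence E x0 x)" for x
  proof -
    \<comment> \<open>Division by zero yields 0, so an isolated vertex would contradict the positive
      lower bound on the quotient.\<close>
    have "valence E x \<noteq> 0" using assms(6)[of x] \<open>c > 0\<close> by (intro notI) simp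
    then show ?thesis using assms(6)[of x] by (simp add: pos_le_divide_eq)
  qed
  have "compact_domain (closure (laplacian_fin E))"
    unfolding compact_domain_def
  proof (intro allI impI)
    fix f g :: "nat \<Rightarrow> 'v ell2" and K assume fg: "\<forall>n. (f n, g n) \<in> closure (laplacian_fin E) \<and> norm (f n) \<le> K \<and> norm (g n) \<le> K"
    show "\<exists>l r. strict_mono (r :: nat \<Rightarrow> nat) \<and> (f \<circ> r) \<longlonglongrightarrow> l"
    proof (rule ell2_weighted_compact)
      show "finite {x. valence E x < V}" for V by (rule finite_small_valence[OF assms(4,7)])
      show "norm (f n) \<le> K" for n using fg by blast
      fix n and F :: "'v set" assume F: "finite F"
      have "(\<Sum>x\<in>F. real (valence E x) * (ell2_fun (f n) x)\<^sup>2) \<le> 2 / c\<^sup>2 * inner (f n) (g n)"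
        using fg by (intro hardy_closure_laplacian_fin[OF \<open>c > 0\<close> radial _ F]) blast
      \<comment> \<open>Cauchy-Schwarz turns the graph norm bound into a bound on the quadratic
        form, uniform in \<open>n\<close> and \<open>F\<close>.\<close>
      also have "\<dots> \<le> 2 / c\<^sup>2 * (K * K)"
      proof (rule mult_left_mono)
        have "inner (f n) (g n) \<le> norm (f n) * norm (g n)" by (rule norm_cauchy_schwarz)
        also have "\<dots> \<le> K * K"
        proof (rule mult_mono)
          show "norm (f n) \<le> K" "norm (g n) \<le> K" using fg by blast+
          then show "0 \<le> K" using norm_ge_zero[of "f n"] by linarith
        qed simp
        finally show "inner (f n) (g n) \<le> K * K" .
      qed simp
      finally show "(\<Sum>x\<in>F. real (valence E x) * (ell2_fun (f n) x)\<^sup>2) \<le> 2 / c\<^sup>2 * (K * K)" .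
    qed
  qed
  then show ?thesis
    unfolding laplacian_sa_eq_closure
    by (intro essential_spectrum_empty_if_compact_domain self_adjoint_closure_laplacian_fin)
qed

end
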